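(* Let $A^\bullet$ be a $1$-finite cdga, with holonomy Lie algebra $\mathfrak{h}(A)$. Then: (1) $\mathcal{R}^1_1(A)\nsubseteq\{0\}$ if and only if $\operatorname{Hom}_{\mathrm{Lie}}(\mathfrak{h}(A),\mathfrak{sol}_2)$ contains a surjection. (2) $\mathcal{R}^1_1(H^\bullet(A))\nsubseteq\{0\}$ if and only if $\operatorname{Hom}_{\mathrm{Lie}}(\mathfrak{h}(A),\mathfrak{heis}_3)$ contains a surjection.
   Context: Everything is over $\mathbb{C}$. A cdga is a (graded-)commutative, non-negatively graded differential graded algebra $A=(A^\bullet,d)$; it is connected if $A^0=\mathbb{C}\cdot1$, and $1$-finite if it is connected and $A^1$ is finite-dimensional. $H^\bullet(A)$ is viewed as a cdga with zero differential. For a connected cdga $A$, the rank one resonance variety is $\mathcal{R}^1_1(A)=\{\alpha\in H^1(A)=Z^1(A)\mid H^1(A,d_\alpha)\ne0\}$, where $d_\alpha(\beta)=d\beta+\alpha\beta$. $\mathfrak{sol}_2$ is the standard Borel subalgebra of $\mathfrak{sl}_2$ (the $2$-dimensional nonabelian Lie algebra). $\mathfrak{heis}_3$ is the $3$-dimensional Heisenberg Lie algebra (basis $x,y,z$, $[x,y]=z$ up to sign, $z$ central). Holonomy Lie algebra: put $A_i=(A^i)^*$, let $\mathbf{L}(A_1)$ be the free Lie algebra on $A_1$, with $\mathbf{L}^1(A_1)=A_1$ and $\mathbf{L}^2(A_1)=A_1\wedge A_1$ via $[u,v]\leftrightarrow u\wedge v$, and let $d^*\colon A_2\to A_1$ and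 $\cup^*\colon A_2\to A_1\wedge A_1$ be the duals of $d\colon A^1\to A^2$ and of the product $\cup\colon A^1\wedge A^1\to A^2$. Then $\mathfrak{h}(A)=\mathbf{L}(A_1)/\mathrm{ideal}(\operatorname{im}(d^*+\cup^* ))$. *)

theory Defs
  imports "Jordan_Normal_Form.VS_Connect" "HOL-Algebra.QuotRing"
begin

text \<open>
  The ground field is \<^term>\<open>class_ring :: complex ring\<close>. Vector spaces are \<^locale>\<open>vectorspace\<close>s
  over it. In the module records built below, the fields \<open>mult\<close> and \<open>one\<close> (inherited from
  rings) carry no meaning.
\<close>

definition quotient_space ::
  "(complex, 'a, 'm) module_scheme \<Rightarrow> 'a set \<Rightarrow> (complex, 'a set) module" where
  "quotient_space V W =
     \<lparr>carrier = a_rcosets\<^bsub>V\<^esub> W, mult = undefined, one = undefined,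
      zero = W, add = set_add V,
      smult = (\<lambda>c X. \<Union>x\<in>X. W +>\<^bsub>V\<^esub> (c \<odot>\<^bsub>V\<^esub> x))\<rparr>"

text \<open>Elements of the dual are functions that are \<open>undefined\<close> outside the carrier, so that two
  functionals agreeing on the space are equal.\<close>

definition dual_space ::
  "(complex, 'a, 'm) module_scheme \<Rightarrow> (complex, 'a \<Rightarrow> complex) module" where
  "dual_space V =
     \<lparr>carrier = {f \<in> extensional (carrier V).
        (\<forall>x\<in>carrier V. \<forall>y\<in>carrier V. f (x \<oplus>\<^bsub>V\<^esub> y) = f x + f y) \<and>
        (\<forall>c. \<forall>x\<in>carrier V. f (c \<odot>\<^bsub>V\<^esub> x) = c * f x)},
      mult = undefined, one = undefined,
      zero = (\<lambda>x\<in>carrier V. 0),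
      add = (\<lambda>f g. \<lambda>x\<in>carrier V. f x + g x),
      smult = (\<lambda>c f. \<lambda>x\<in>carrier V. c * f x)\<rparr>"


section \<open>Commutative differential graded algebras\<close>

text \<open>A graded algebra is the family of its homogeneous components; \<open>gmult A i j\<close> is the product
  \<open>A\<^sup>i \<times> A\<^sup>j \<rightarrow> A\<^bsup>i+j\<^esup>\<close> and \<open>gdiff A i\<close> is \<open>d : A\<^sup>i \<rightarrow> A\<^bsup>i+1\<^esup>\<close>.
  The components need not be disjoint subsets of the type \<open>'a\<close>.\<close>

record 'a dga =
  gr :: "nat \<Rightarrow> (complex, 'a) module"
  gmult :: "nat \<Rightarrow> nat \<Rightarrow> 'a \<Rightarrow> 'a \<Rightarrow> 'a"
  gone :: 'a
  gdiff :: "nat \<Rightarrow> 'a \<Rightarrow> 'a"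

locale cdga =
  fixes A :: "'a dga"
  assumes gr_vectorspace: "vectorspace class_ring (gr A i)"
    and gmult_linear_right:
      "x \<in> carrier (gr A i) \<Longrightarrow>
         gmult A i j x \<in> LinearCombinations.module_hom class_ring (gr A j) (gr A (i + j))"
    and gmult_linear_left:
      "y \<in> carrier (gr A j) \<Longrightarrow>
         (\<lambda>x. gmult A i j x y) \<in> LinearCombinations.module_hom class_ring (gr A i) (gr A (i + j))"
    and gmult_assoc:
      "\<lbrakk>x \<in> carrier (gr A i); y \<in> carrier (gr A j); z \<in> carrier (gr A k)\<rbrakk> \<Longrightarrow>
         gmult A (i + j) k (gmult A i j x y) z = gmult A i (j + k) x (gmult A j k y z)"
    and gone_closed: "gone A \<in> carrier (gr A 0)"
    and gone_left: "x \<in> carrier (gr A i) \<Longrightarrow> gmult A 0 i (gone A) x = x"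
    and gone_right: "x \<in> carrier (gr A i) \<Longrightarrow> gmult A i 0 x (gone A) = x"
    and graded_commutative:
      "\<lbrakk>x \<in> carrier (gr A i); y \<in> carrier (gr A j)\<rbrakk> \<Longrightarrow>
         gmult A j i y x = (- 1) ^ (i * j) \<odot>\<^bsub>gr A (i + j)\<^esub> gmult A i j x y"
    and gdiff_linear: "gdiff A i \<in> LinearCombinations.module_hom class_ring (gr A i) (gr A (i + 1))"
    and gdiff_gdiff:
      "x \<in> carrier (gr A i) \<Longrightarrow> gdiff A (i + 1) (gdiff A i x) = \<zero>\<^bsub>gr A (i + 2)\<^esub>"
    and leibniz:
      "\<lbrakk>x \<in> carrier (gr A i); y \<in> carrier (gr A j)\<rbrakk> \<Longrightarrow>
         gdiff A (i + j) (gmult A i j x y) =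
           gmult A (i + 1) j (gdiff A i x) y \<oplus>\<^bsub>gr A (i + j + 1)\<^esub>
           ((- 1) ^ i \<odot>\<^bsub>gr A (i + j + 1)\<^esub> gmult A i (j + 1) x (gdiff A j y))"

locale connected_cdga = cdga +
  assumes connected: "carrier (gr A 0) = range (\<lambda>c. c \<odot>\<^bsub>gr A 0\<^esub> gone A)"

locale one_finite_cdga = connected_cdga +
  assumes fin_dim_one: "vectorspace.fin_dim class_ring (gr A 1)"


section \<open>Cohomology and resonance\<close>

definition cocycles ::
  "(nat \<Rightarrow> (complex, 'a) module) \<Rightarrow> (nat \<Rightarrow> 'a \<Rightarrow> 'a) \<Rightarrow> nat \<Rightarrow> 'a set" where
  "cocycles V D i = {x \<in> carrier (V i). D i x = \<zero>\<^bsub>V (i + 1)\<^esub>}"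

definition coboundaries ::
  "(nat \<Rightarrow> (complex, 'a) module) \<Rightarrow> (nat \<Rightarrow> 'a \<Rightarrow> 'a) \<Rightarrow> nat \<Rightarrow> 'a set" where
  "coboundaries V D i = (case i of 0 \<Rightarrow> {\<zero>\<^bsub>V 0\<^esub>} | Suc k \<Rightarrow> D k ` carrier (V k))"

definition cohomology ::
  "(nat \<Rightarrow> (complex, 'a) module) \<Rightarrow> (nat \<Rightarrow> 'a \<Rightarrow> 'a) \<Rightarrow> nat \<Rightarrow> (complex, 'a set) module" where
  "cohomology V D i = quotient_space ((V i)\<lparr>carrier := cocycles V D i\<rparr>) (coboundaries V D i)"

definition cohomology_algebra :: "'a dga \<Rightarrow> 'a set dga" where
  "cohomology_algebra A =
     \<lparr>gr = cohomology (gr A) (gdiff A),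
      gmult = (\<lambda>i j X Y. \<Union>x\<in>X. \<Union>y\<in>Y.
        coboundaries (gr A) (gdiff A) (i + j) +>\<^bsub>gr A (i + j)\<^esub> gmult A i j x y),
      gone = coboundaries (gr A) (gdiff A) 0 +>\<^bsub>gr A 0\<^esub> gone A,
      gdiff = (\<lambda>i X. \<zero>\<^bsub>cohomology (gr A) (gdiff A) (i + 1)\<^esub>)\<rparr>"

definition twisted_diff :: "'a dga \<Rightarrow> 'a \<Rightarrow> nat \<Rightarrow> 'a \<Rightarrow> 'a" where
  "twisted_diff A \<alpha> i \<beta> = gdiff A i \<beta> \<oplus>\<^bsub>gr A (i + 1)\<^esub> gmult A 1 i \<alpha> \<beta>"

text \<open>For connected \<open>A\<close> one has \<open>d(A\<^sup>0) = 0\<close>, so \<open>H\<^sup>1(A)\<close> is identified with the cocycles in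
  degree one.\<close>

definition resonance :: "'a dga \<Rightarrow> 'a set" where
  "resonance A =
     {\<alpha> \<in> cocycles (gr A) (gdiff A) 1.
        carrier (cohomology (gr A) (twisted_diff A \<alpha>) 1) \<noteq>
          {\<zero>\<^bsub>cohomology (gr A) (twisted_diff A \<alpha>) 1\<^esub>}}"


section \<open>Lie algebras\<close>

text \<open>The record is used for arbitrary nonassociative algebras, in particular for the free one
  from which the free Lie algebra is obtained as a quotient.\<close>

record 'a bracket_algebra = "(complex, 'a) module" +
  bracket :: "'a \<Rightarrow> 'a \<Rightarrow> 'a"

definition lie_hom :: "'a bracket_algebra \<Rightarrow> 'b bracket_algebra \<Rightarrow> ('a \<Rightarrow> 'b) set" where
  "lie_hom L M = {f \<in> LinearCombinations.module_hom class_ring L M.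
     \<forall>x\<in>carrier L. \<forall>y\<in>carrier L. f (bracket L x y) = bracket M (f x) (f y)}"

definition bracket_ideal :: "'a set \<Rightarrow> 'a bracket_algebra \<Rightarrow> bool" where
  "bracket_ideal I L \<longleftrightarrow> submodule class_ring I L \<and>
     (\<forall>x\<in>carrier L. \<forall>y\<in>I. bracket L x y \<in> I \<and> bracket L y x \<in> I)"

definition generated_ideal :: "'a bracket_algebra \<Rightarrow> 'a set \<Rightarrow> 'a set" where
  "generated_ideal L S = \<Inter>{I. bracket_ideal I L \<and> S \<subseteq> I}"

definition quotient_algebra :: "'a bracket_algebra \<Rightarrow> 'a set \<Rightarrow> 'a set bracket_algebra" where
  "quotient_algebra L I =
     \<lparr>carrier = a_rcosets\<^bsub>L\<^esub> I, mult = undefined, one = undefined,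
      zero = I, add = set_add L,
      smult = (\<lambda>c X. \<Union>x\<in>X. I +>\<^bsub>L\<^esub> (c \<odot>\<^bsub>L\<^esub> x)),
      bracket = (\<lambda>X Y. \<Union>x\<in>X. \<Union>y\<in>Y. I +>\<^bsub>L\<^esub> bracket L x y)\<rparr>"

text \<open>The free nonassociative algebra on a set \<open>X\<close>: finitely supported functions on the free
  magma over \<open>X\<close>.\<close>

datatype 'x magma = Gen 'x | Br "'x magma" "'x magma"

definition free_nonassoc :: "'x set \<Rightarrow> ('x magma \<Rightarrow> complex) bracket_algebra" where
  "free_nonassoc X =
     \<lparr>carrier = {p. finite {w. p w \<noteq> 0} \<and> (\<forall>w. p w \<noteq> 0 \<longrightarrow> set_magma w \<subseteq> X)},
      mult = undefined, one = undefined,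
      zero = (\<lambda>w. 0),
      add = (\<lambda>p q w. p w + q w),
      smult = (\<lambda>c p w. c * p w),
      bracket = (\<lambda>p q w. case w of Gen x \<Rightarrow> 0 | Br s t \<Rightarrow> p s * q t)\<rparr>"

definition generator :: "'x \<Rightarrow> 'x magma \<Rightarrow> complex" where
  "generator x = (\<lambda>w. if w = Gen x then 1 else 0)"

text \<open>The free Lie algebra on a vector space \<open>V\<close> (not merely on its underlying set): besides the
  Lie algebra identities, the linear relations of \<open>V\<close> are imposed on the generators.\<close>

definition free_lie_relations ::
  "(complex, 'v, 'm) module_scheme \<Rightarrow> ('v magma \<Rightarrow> complex) set" where
  "free_lie_relations V = (let F = free_nonassoc (carrier V) in
     {generator (u \<oplus>\<^bsub>V\<^esub> v) \<ominus>\<^bsub>F\<^esub> (generator u \<oplus>\<^bsub>F\<^esub> generator v) |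
        u v. u \<in> carrier V \<and> v \<in> carrier V} \<union>
     {generator (c \<odot>\<^bsub>V\<^esub> u) \<ominus>\<^bsub>F\<^esub> (c \<odot>\<^bsub>F\<^esub> generator u) | c u. u \<in> carrier V} \<union>
     {bracket F p p | p. p \<in> carrier F} \<union>
     {bracket F p (bracket F q r) \<oplus>\<^bsub>F\<^esub> bracket F q (bracket F r p)
        \<oplus>\<^bsub>F\<^esub> bracket F r (bracket F p q) |
        p q r. p \<in> carrier F \<and> q \<in> carrier F \<and> r \<in> carrier F})"

definition free_lie ::
  "(complex, 'v, 'm) module_scheme \<Rightarrow> ('v magma \<Rightarrow> complex) set bracket_algebra" where
  "free_lie V = quotient_algebra (free_nonassoc (carrier V))
     (generated_ideal (free_nonassoc (carrier V)) (free_lie_relations V))"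

definition free_lie_incl ::
  "(complex, 'v, 'm) module_scheme \<Rightarrow> 'v \<Rightarrow> ('v magma \<Rightarrow> complex) set" where
  "free_lie_incl V v =
     generated_ideal (free_nonassoc (carrier V)) (free_lie_relations V)
       +>\<^bsub>free_nonassoc (carrier V)\<^esub> generator v"


section \<open>The holonomy Lie algebra\<close>

definition diff_dual :: "'a dga \<Rightarrow> ('a \<Rightarrow> complex) \<Rightarrow> 'a \<Rightarrow> complex" where
  "diff_dual A \<phi> = (\<lambda>a\<in>carrier (gr A 1). \<phi> (gdiff A 1 a))"

text \<open>With \<open>A\<^sub>1\<close> finite-dimensional, \<open>A\<^sub>1 \<and> A\<^sub>1\<close> is the space of alternating bilinear forms on
  \<open>A\<^sup>1\<close> through \<open>(u \<and> v)(a, b) = u(a) v(b) - u(b) v(a)\<close>, and the dual of the product sends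
  \<open>\<phi> \<in> A\<^sub>2\<close> to the form \<open>(a, b) \<mapsto> \<phi>(a b)\<close>.\<close>

definition wedge :: "'a dga \<Rightarrow> ('a \<Rightarrow> complex) \<Rightarrow> ('a \<Rightarrow> complex) \<Rightarrow> 'a \<Rightarrow> 'a \<Rightarrow> complex" where
  "wedge A u v = (\<lambda>a\<in>carrier (gr A 1). \<lambda>b\<in>carrier (gr A 1). u a * v b - u b * v a)"

definition cup_dual :: "'a dga \<Rightarrow> ('a \<Rightarrow> complex) \<Rightarrow> 'a \<Rightarrow> 'a \<Rightarrow> complex" where
  "cup_dual A \<phi> = (\<lambda>a\<in>carrier (gr A 1). \<lambda>b\<in>carrier (gr A 1). \<phi> (gmult A 1 1 a b))"

text \<open>The elements \<open>d\<^sup>*\<phi> + \<union>\<^sup>*\<phi>\<close> of \<open>L\<^sup>1 \<oplus> L\<^sup>2\<close>. The identification \<open>u \<and> v \<leftrightarrow> [u, v]\<close> is applied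
  to an expression of \<open>\<union>\<^sup>*\<phi>\<close> as a finite sum of decomposable elements \<open>u\<^sub>k \<and> v\<^sub>k\<close>; the
  resulting element of \<open>L\<^sup>2\<close> does not depend on the expression.\<close>

definition holonomy_relations :: "'a dga \<Rightarrow> (('a \<Rightarrow> complex) magma \<Rightarrow> complex) set set" where
  "holonomy_relations A = (let A\<^sub>1 = dual_space (gr A 1); L = free_lie A\<^sub>1; \<iota> = free_lie_incl A\<^sub>1 in
     {\<iota> (diff_dual A \<phi>) \<oplus>\<^bsub>L\<^esub> (\<Oplus>\<^bsub>L\<^esub>k\<in>{..<n}. bracket L (\<iota> (u k)) (\<iota> (v k))) |
        \<phi> (n :: nat) u v.
        \<phi> \<in> carrier (dual_space (gr A 2)) \<and>
        u \<in> {..<n} \<rightarrow> carrier A\<^sub>1 \<and> v \<in> {..<n} \<rightarrow> carrier A\<^sub>1 \<and>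
        (\<forall>a\<in>carrier (gr A 1). \<forall>b\<in>carrier (gr A 1).
           cup_dual A \<phi> a b = (\<Sum>k<n. wedge A (u k) (v k) a b))})"

definition holonomy_lie ::
  "'a dga \<Rightarrow> (('a \<Rightarrow> complex) magma \<Rightarrow> complex) set set bracket_algebra" where
  "holonomy_lie A =
     (let L = free_lie (dual_space (gr A 1))
      in quotient_algebra L (generated_ideal L (holonomy_relations A)))"


section \<open>The target Lie algebras\<close>

text \<open>The standard Borel subalgebra of \<open>sl\<^sub>2\<close>: upper triangular traceless matrices.\<close>

definition sol2 :: "complex mat bracket_algebra" where
  "sol2 =
     \<lparr>carrier = {M \<in> carrier_mat 2 2. (\<Sum>i<2. M $$ (i, i)) = 0 \<and> upper_triangular M},
      mult = undefined, one = undefined,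
      zero = 0\<^sub>m 2 2, add = (+), smult = (\<cdot>\<^sub>m),
      bracket = (\<lambda>M N. M * N - N * M)\<rparr>"

text \<open>Coordinates with respect to a basis \<open>x, y, z\<close> with \<open>[x, y] = z\<close> and \<open>z\<close> central.\<close>

definition heis3 :: "(complex \<times> complex \<times> complex) bracket_algebra" where
  "heis3 =
     \<lparr>carrier = UNIV, mult = undefined, one = undefined,
      zero = (0, 0, 0),
      add = (\<lambda>(a, b, c) (a', b', c'). (a + a', b + b', c + c')),
      smult = (\<lambda>r (a, b, c). (r * a, r * b, r * c)),
      bracket = (\<lambda>(a, b, c) (a', b', c'). (0, 0, a * b' - a' * b))\<rparr>"

end

theory Submission
  imports Defs
begin

text \<open>A Lie algebra homomorphism from the holonomy Lie algebra to \<open>M\<close> is the same thing as a linear map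
\<open>G : A\<^sub>1 \<rightarrow> M\<close> that kills every relator \<open>d\<^sup>*\<phi> + \<union>\<^sup>*\<phi>\<close> (\<open>lie_hom_flat\<close>, \<open>flat_map_extends\<close>). Such
maps are called flat here: since \<open>A\<^sup>1\<close> is finite-dimensional, hence reflexive, the coordinates of
\<open>G\<close> with respect to a basis of \<open>M\<close> are evaluations at elements of \<open>A\<^sup>1\<close>, so \<open>G\<close> is an element of
\<open>A\<^sup>1 \<otimes> M\<close>. Functionals separate the points of \<open>A\<^sup>2\<close>, even if that space is infinite-dimensional,
and therefore \<open>G\<close> kills all relators if and only if this element satisfies the Maurer-Cartan
equation in \<open>A\<^sup>2 \<otimes> M\<close> (\<open>relator_coordinate\<close>, \<open>maurer_cartan\<close>).

For \<open>sol\<^sub>2\<close>, in coordinates with bracket \<open>[(x, y), (x', y')] = (0, x y' - x' y)\<close>, the equation says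
\<open>d\<alpha> = 0\<close> and \<open>d\<beta> + \<alpha>\<beta> = 0\<close>. For \<open>heis\<^sub>3\<close> it says \<open>d\<alpha> = d\<beta> = 0\<close> and \<open>d\<gamma> + \<alpha>\<beta> = 0\<close>. In both cases
the homomorphism is onto if and only if \<open>\<alpha>\<close> and \<open>\<beta>\<close> are linearly independent
(\<open>surjective_iff_independent\<close>): a relation \<open>s\<alpha> + t\<beta> = 0\<close> confines the image to a proper subalgebra,
while independence allows the first two coordinates to be prescribed, and elements with independent
first two coordinates generate the algebra.

The resonance varieties give the same data. As \<open>A\<close> is connected, the coboundaries of \<open>d\<^sub>\<alpha>\<close> in degree
one form the line through \<open>\<alpha>\<close>. A nonzero \<open>\<alpha>\<close> thus belongs to the resonance variety of \<open>A\<close> if and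
only if \<open>d\<alpha> = 0\<close> and some \<open>\<beta>\<close> independent of \<open>\<alpha>\<close> has \<open>d\<beta> + \<alpha>\<beta> = 0\<close>. For the cohomology algebra the
differential vanishes, so the condition is that \<open>\<alpha>\<close> and \<open>\<beta>\<close> are cocycles whose product is zero in
\<open>H\<^sup>2(A)\<close>, and \<open>\<gamma>\<close> is a primitive of \<open>- \<alpha>\<beta>\<close>.\<close>

section \<open>Complex vector spaces, functionals and duality\<close>

locale cspace = vectorspace "class_ring :: complex ring" V
  for V :: "(complex, 'v, 'm) module_scheme" (structure)
begin

lemma add_smult: "x \<in> carrier V \<Longrightarrow> (a + b) \<odot> x = a \<odot> x \<oplus> b \<odot> x"
  using smult_l_distr[of a b x] by simp

lemma smult_add: "x \<in> carrier V \<Longrightarrow> y \<in> carrier V \<Longrightarrow> a \<odot> (x \<oplus> y) = a \<odot> x \<oplus> a \<odot> y"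
  using smult_r_distr[of a x y] by simp

lemma smult_smult: "x \<in> carrier V \<Longrightarrow> a \<odot> (b \<odot> x) = (a * b) \<odot> x"
  using smult_assoc1[of a b x] by simp

lemma one_smult [simp]: "x \<in> carrier V \<Longrightarrow> 1 \<odot> x = x"
  using smult_one[of x] by simp

lemma zero_smult [simp]: "x \<in> carrier V \<Longrightarrow> 0 \<odot> x = \<zero>"
  using smult_l_null[of x] by simp

lemma smult_zero [simp]: "a \<odot> \<zero> = \<zero>"
  using smult_r_null[of a] by simp

lemma smult_in [simp, intro]: "x \<in> carrier V \<Longrightarrow> a \<odot> x \<in> carrier V"
  using smult_closed[of a x] by simp

lemma minus_smult: "x \<in> carrier V \<Longrightarrow> \<ominus> x = (- 1) \<odot> x"
  using add_smult[of x "- 1" 1] by (intro M.minus_equality) auto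

lemma add_neg_smult [simp]: "x \<in> carrier V \<Longrightarrow> x \<oplus> (- 1) \<odot> x = \<zero>"
  by (simp add: M.r_neg flip: minus_smult)

lemma eq_if_diff_zero: "x \<in> carrier V \<Longrightarrow> y \<in> carrier V \<Longrightarrow> x \<oplus> (- 1) \<odot> y = \<zero> \<Longrightarrow> x = y"
  by (metis M.minus_other_side a_minus_def minus_smult)

lemma cspace_V: "cspace V" ..

end

text \<open>The negative of \<open>x\<close> is \<open>(- 1) \<odot> x\<close>, so additive inverses come for free from the scalar laws.\<close>

lemma cspaceI:
  fixes V :: "(complex, 'v, 'm) module_scheme" (structure)
  assumes "\<zero> \<in> carrier V"
    and "\<And>x y. x \<in> carrier V \<Longrightarrow> y \<in> carrier V \<Longrightarrow> x \<oplus> y \<in> carrier V"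
    and smult: "\<And>c x. x \<in> carrier V \<Longrightarrow> c \<odot> x \<in> carrier V"
    and "\<And>x y z. x \<in> carrier V \<Longrightarrow> y \<in> carrier V \<Longrightarrow> z \<in> carrier V \<Longrightarrow> (x \<oplus> y) \<oplus> z = x \<oplus> (y \<oplus> z)"
    and "\<And>x y. x \<in> carrier V \<Longrightarrow> y \<in> carrier V \<Longrightarrow> x \<oplus> y = y \<oplus> x"
    and "\<And>x. x \<in> carrier V \<Longrightarrow> \<zero> \<oplus> x = x"
    and add_smult: "\<And>a b x. x \<in> carrier V \<Longrightarrow> (a + b) \<odot> x = a \<odot> x \<oplus> b \<odot> x"
    and "\<And>a x y. x \<in> carrier V \<Longrightarrow> y \<in> carrier V \<Longrightarrow> a \<odot> (x \<oplus> y) = a \<odot> x \<oplus> a \<odot> y"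
    and "\<And>a b x. x \<in> carrier V \<Longrightarrow> (a * b) \<odot> x = a \<odot> (b \<odot> x)"
    and one: "\<And>x. x \<in> carrier V \<Longrightarrow> 1 \<odot> x = x"
    and zero: "\<And>x. x \<in> carrier V \<Longrightarrow> 0 \<odot> x = \<zero>"
  shows "cspace V"
proof -
  have inv: "\<exists>y\<in>carrier V. y \<oplus> x = \<zero>" if "x \<in> carrier V" for x
    using add_smult[OF that, of "- 1" 1] one[OF that] zero[OF that] smult[OF that] by auto
  have "abelian_group V"
    by (rule abelian_groupI) (use assms inv in auto)
  then have "module (class_ring :: complex ring) V"
    by (intro moduleI) (use assms in \<open>auto intro: class_cring.is_cring\<close>)
  then show ?thesis
    unfolding cspace_def vectorspace_def by (simp add: class_field)
qed

lemma (in cspace) subspaceI: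
  assumes "W \<subseteq> carrier V" "\<zero> \<in> W"
    and "\<And>x y. x \<in> W \<Longrightarrow> y \<in> W \<Longrightarrow> x \<oplus> y \<in> W"
    and "\<And>c x. x \<in> W \<Longrightarrow> c \<odot> x \<in> W"
  shows "LinearCombinations.submodule class_ring W V"
  using assms module_axioms by (intro LinearCombinations.submodule.intro) auto

lemma subspaceD:
  fixes V (structure)
  assumes "LinearCombinations.submodule (class_ring :: complex ring) W V"
  shows "W \<subseteq> carrier V" "\<zero> \<in> W"
    and "\<And>x y. x \<in> W \<Longrightarrow> y \<in> W \<Longrightarrow> x \<oplus> y \<in> W"
    and "\<And>c x. x \<in> W \<Longrightarrow> c \<odot> x \<in> W"
  using assms by (auto simp: LinearCombinations.submodule_def)

abbreviation linear_maps ::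
  "(complex, 'v, 'm) module_scheme \<Rightarrow> (complex, 'w, 'n) module_scheme \<Rightarrow> ('v \<Rightarrow> 'w) set" where
  "linear_maps V W \<equiv> LinearCombinations.module_hom (class_ring :: complex ring) V W"

lemma linearI:
  fixes V (structure) and W (structure)
  assumes "\<And>x. x \<in> carrier V \<Longrightarrow> f x \<in> carrier W"
    and "\<And>x y. x \<in> carrier V \<Longrightarrow> y \<in> carrier V \<Longrightarrow> f (x \<oplus> y) = f x \<oplus>\<^bsub>W\<^esub> f y"
    and "\<And>c x. x \<in> carrier V \<Longrightarrow> f (c \<odot> x) = c \<odot>\<^bsub>W\<^esub> f x"
  shows "f \<in> linear_maps V W"
  using assms by (auto simp: LinearCombinations.module_hom_def)

lemma linearD:
  fixes V (structure)
  assumes "f \<in> linear_maps V W"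
  shows "\<And>x. x \<in> carrier V \<Longrightarrow> f x \<in> carrier W"
    and "\<And>x y. x \<in> carrier V \<Longrightarrow> y \<in> carrier V \<Longrightarrow> f (x \<oplus> y) = f x \<oplus>\<^bsub>W\<^esub> f y"
    and "\<And>c x. x \<in> carrier V \<Longrightarrow> f (c \<odot> x) = c \<odot>\<^bsub>W\<^esub> f x"
  using assms by (auto simp: LinearCombinations.module_hom_def)

lemma linear_zero:
  assumes "cspace V" "cspace W" "f \<in> linear_maps V W"
  shows "f \<zero>\<^bsub>V\<^esub> = \<zero>\<^bsub>W\<^esub>"
proof -
  interpret V: cspace V by fact
  interpret W: cspace W by fact
  have "f (0 \<odot>\<^bsub>V\<^esub> \<zero>\<^bsub>V\<^esub>) = 0 \<odot>\<^bsub>W\<^esub> f \<zero>\<^bsub>V\<^esub>"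
    by (rule linearD(3)[OF assms(3)]) simp
  then show ?thesis using linearD(1)[OF assms(3)] by simp
qed

lemma linear_finsum:
  assumes "cspace V" "cspace W" "f \<in> linear_maps V W" "finite I" "g \<in> I \<rightarrow> carrier V"
  shows "f (\<Oplus>\<^bsub>V\<^esub>i\<in>I. g i) = (\<Oplus>\<^bsub>W\<^esub>i\<in>I. f (g i))"
proof -
  interpret V: cspace V by fact
  interpret W: cspace W by fact
  from assms(4,5) show ?thesis
  proof (induction I)
    case empty
    show ?case by (simp add: linear_zero[OF assms(1-3)])
  next
    case (insert i I)
    then have "finsum V g I \<in> carrier V" "(\<lambda>i. f (g i)) \<in> I \<rightarrow> carrier W"
      using linearD(1)[OF assms(3)] by auto
    with insert show ?case
      using linearD(1,2)[OF assms(3)] by (simp add: Pi_iff)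
  qed
qed

text \<open>The scalars as a one-dimensional space, so that a functional is a linear map.\<close>

definition scalars :: "(complex, complex) module" where
  "scalars = \<lparr>carrier = UNIV, mult = (*), one = 1, zero = 0, add = (+), smult = (*)\<rparr>"

lemma scalars_simps [simp]:
  "carrier scalars = UNIV" "add scalars = (+)" "zero scalars = 0" "smult scalars = (*)"
  by (simp_all add: scalars_def)

lemma cspace_scalars: "cspace scalars"
  by (rule cspaceI) (auto simp: algebra_simps)

lemma finsum_scalars: "finite I \<Longrightarrow> finsum scalars f I = sum f I"
proof -
  interpret cspace scalars by (rule cspace_scalars)
  show "finite I \<Longrightarrow> finsum scalars f I = sum f I"
    by (induction I rule: finite_induct) auto
qed

lemma functional_finsum:
  assumes "cspace V" "f \<in> linear_maps V scalars" "finite I" "g \<in> I \<rightarrow> carrier V"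
  shows "f (\<Oplus>\<^bsub>V\<^esub>i\<in>I. g i) = (\<Sum>i\<in>I. f (g i))"
  using linear_finsum[OF assms(1) cspace_scalars assms(2-4)] finsum_scalars[OF assms(3)] by simp

lemma dual_iff:
  "f \<in> carrier (dual_space V) \<longleftrightarrow> f \<in> extensional (carrier V) \<and> f \<in> linear_maps V scalars"
  by (auto simp: dual_space_def LinearCombinations.module_hom_def)

lemma dualD:
  fixes V (structure)
  assumes "f \<in> carrier (dual_space V)"
  shows "f \<in> linear_maps V scalars" "f \<in> extensional (carrier V)"
    and "\<And>x y. x \<in> carrier V \<Longrightarrow> y \<in> carrier V \<Longrightarrow> f (x \<oplus> y) = f x + f y"
    and "\<And>c x. x \<in> carrier V \<Longrightarrow> f (c \<odot> x) = c * f x"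
  using assms linearD[of f V scalars] by (auto simp: dual_iff)

lemma (in cspace) restrict_dual:
  assumes "f \<in> linear_maps V scalars"
  shows "restrict f (carrier V) \<in> carrier (dual_space V)"
  using linearD[OF assms] by (auto simp: dual_iff intro!: linearI)

lemma dual_ops:
  "add (dual_space V) f g = (\<lambda>x\<in>carrier V. f x + g x)"
  "smult (dual_space V) c f = (\<lambda>x\<in>carrier V. c * f x)"
  "zero (dual_space V) = (\<lambda>x\<in>carrier V. 0)"
  by (simp_all add: dual_space_def)

lemma (in cspace) cspace_dual: "cspace (dual_space V)"
proof (rule cspaceI)
  show "\<zero>\<^bsub>dual_space V\<^esub> \<in> carrier (dual_space V)"
    unfolding dual_ops by (rule restrict_dual) (auto intro!: linearI)
  fix x y assume x: "x \<in> carrier (dual_space V)" and y: "y \<in> carrier (dual_space V)"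
  show "x \<oplus>\<^bsub>dual_space V\<^esub> y \<in> carrier (dual_space V)"
    unfolding dual_ops using dualD[OF x] dualD[OF y]
    by (intro restrict_dual linearI) (auto simp: algebra_simps)
next
  fix c x assume x: "x \<in> carrier (dual_space V)"
  show "c \<odot>\<^bsub>dual_space V\<^esub> x \<in> carrier (dual_space V)"
    unfolding dual_ops using dualD[OF x]
    by (intro restrict_dual linearI) (auto simp: algebra_simps)
next
  fix x assume x: "x \<in> carrier (dual_space V)"
  show "\<zero>\<^bsub>dual_space V\<^esub> \<oplus>\<^bsub>dual_space V\<^esub> x = x"
    unfolding dual_ops using dualD(2)[OF x] by (auto simp: fun_eq_iff extensional_def)
  show "1 \<odot>\<^bsub>dual_space V\<^esub> x = x"
    unfolding dual_ops using dualD(2)[OF x] by (auto simp: fun_eq_iff extensional_def)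
qed (auto simp: dual_ops fun_eq_iff algebra_simps)

lemma (in cspace) evaluation_linear:
  "v \<in> carrier V \<Longrightarrow> (\<lambda>f. f v) \<in> linear_maps (dual_space V) scalars"
  by (rule linearI) (auto simp: dual_ops)

text \<open>Zorn's lemma gives a subspace maximal among those that contain \<open>W\<close> and avoid \<open>y\<close>.
  Adjoining any further vector captures \<open>y\<close>, so this subspace is a complement of the line
  through \<open>y\<close>, and the functional is the coordinate along that line.\<close>

lemma (in cspace) separating_functional:
  assumes W: "LinearCombinations.submodule class_ring W V"
    and y: "y \<in> carrier V" "y \<notin> W"
  obtains \<phi> where "\<phi> \<in> carrier (dual_space V)" "\<And>w. w \<in> W \<Longrightarrow> \<phi> w = 0" "\<phi> y = 1"
proof -
  define \<A> where "\<A> = {U. LinearCombinations.submodule class_ring U V \<and> W \<subseteq> U \<and> y \<notin> U}"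
  have "\<exists>U\<in>\<A>. \<forall>X\<in>\<A>. U \<subseteq> X \<longrightarrow> X = U"
  proof (rule subset_Zorn_nonempty)
    show "\<A> \<noteq> {}" using W y by (auto simp: \<A>_def)
    fix \<C> assume ne: "\<C> \<noteq> {}" and chain: "subset.chain \<A> \<C>"
    have sub: "LinearCombinations.submodule class_ring U V" "W \<subseteq> U" "y \<notin> U" if "U \<in> \<C>" for U
      using chain that by (auto simp: subset.chain_def \<A>_def)
    have "LinearCombinations.submodule class_ring (\<Union>\<C>) V"
    proof (rule subspaceI)
      show "\<Union>\<C> \<subseteq> carrier V"
        using subspaceD(1)[OF sub(1)] by auto
      show "\<zero> \<in> \<Union>\<C>"
        using ne subspaceD(2)[OF sub(1)] by auto
      show "c \<odot> x \<in> \<Union>\<C>" if "x \<in> \<Union>\<C>" for c x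
        using that subspaceD(4)[OF sub(1)] by auto
      fix x x' assume "x \<in> \<Union>\<C>" "x' \<in> \<Union>\<C>"
      then obtain U U' where "U \<in> \<C>" "U' \<in> \<C>" "x \<in> U" "x' \<in> U'" by auto
      moreover from this have "U \<subseteq> U' \<or> U' \<subseteq> U"
        using chain by (auto simp: subset.chain_def)
      ultimately obtain U'' where U'': "U'' \<in> \<C>" "x \<in> U''" "x' \<in> U''" by blast
      then show "x \<oplus> x' \<in> \<Union>\<C>"
        using subspaceD(3)[OF sub(1)[OF U''(1)]] by auto
    qed
    then show "\<Union>\<C> \<in> \<A>" using ne sub(2,3) by (auto simp: \<A>_def)
  qed
  then obtain U where U\<A>: "U \<in> \<A>" and maximal: "\<And>X. X \<in> \<A> \<Longrightarrow> U \<subseteq> X \<Longrightarrow> X = U" by auto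
  have U: "LinearCombinations.submodule class_ring U V" and WU: "W \<subseteq> U" and yU: "y \<notin> U"
    using U\<A> by (auto simp: \<A>_def)
  note U_props = subspaceD[OF U]
  have U_in: "\<And>u. u \<in> U \<Longrightarrow> u \<in> carrier V" using U_props(1) by auto
  have ex: "\<exists>c. \<exists>u\<in>U. v = u \<oplus> c \<odot> y" if v: "v \<in> carrier V" for v
  proof (cases "v \<in> U")
    case True
    then have "v = v \<oplus> 0 \<odot> y" using v y by simp
    with True show ?thesis by blast
  next
    case False
    define X where "X = {u \<oplus> c \<odot> v | u c. u \<in> U}"
    have "LinearCombinations.submodule class_ring X V"
    proof (rule subspaceI)
      show "X \<subseteq> carrier V" using U_in v by (auto simp: X_def)
      show "\<zero> \<in> X" using U_props(2) v by (auto simp: X_def intro!: exI[of _ \<zero>] exI[of _ 0])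
      fix x x' assume "x \<in> X" "x' \<in> X"
      then obtain u c u' c' where x: "x = u \<oplus> c \<odot> v" "x' = u' \<oplus> c' \<odot> v" "u \<in> U" "u' \<in> U"
        by (auto simp: X_def)
      then have "x \<oplus> x' = (u \<oplus> u') \<oplus> (c + c') \<odot> v"
        using U_in v by (simp add: add_smult M.a_ac)
      then show "x \<oplus> x' \<in> X" using x U_props(3) unfolding X_def by blast
    next
      fix a x assume "x \<in> X"
      then obtain u c where x: "x = u \<oplus> c \<odot> v" "u \<in> U" by (auto simp: X_def)
      then have "a \<odot> x = a \<odot> u \<oplus> (a * c) \<odot> v"
        using U_in v by (simp add: smult_add smult_smult)
      then show "a \<odot> x \<in> X" using x U_props(4) unfolding X_def by blast
    qed
    moreover have UX: "U \<subseteq> X"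
    proof
      fix u assume "u \<in> U"
      moreover from this have "u = u \<oplus> 0 \<odot> v" using U_in v by simp
      ultimately show "u \<in> X" unfolding X_def by blast
    qed
    moreover have "v \<in> X"
    proof -
      have "v = \<zero> \<oplus> 1 \<odot> v" using v by simp
      then show ?thesis using U_props(2) unfolding X_def by blast
    qed
    then have "X \<noteq> U" using False by auto
    ultimately have "y \<in> X" using maximal[of X] WU by (auto simp: \<A>_def)
    then obtain u c where yc: "y = u \<oplus> c \<odot> v" and u: "u \<in> U" by (auto simp: X_def)
    have "c \<noteq> 0"
    proof
      assume "c = 0"
      then show False using yc u U_in v yU by simp
    qed
    have "(- 1 / c) \<odot> u \<oplus> (1 / c) \<odot> y = (- 1 / c) \<odot> u \<oplus> (1 / c) \<odot> u \<oplus> v"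
      using u U_in v \<open>c \<noteq> 0\<close> by (simp add: yc smult_add smult_smult M.a_assoc)
    also have "(- 1 / c) \<odot> u \<oplus> (1 / c) \<odot> u = \<zero>"
      using u U_in by (simp flip: add_smult)
    finally have "v = (- 1 / c) \<odot> u \<oplus> (1 / c) \<odot> y" using v by simp
    then show ?thesis using u U_props(4) by blast
  qed
  have unique: "c = c'" if "u \<in> U" "u' \<in> U" "u \<oplus> c \<odot> y = u' \<oplus> c' \<odot> y" for u u' c c'
  proof (rule ccontr)
    assume "c \<noteq> c'"
    have "(c - c') \<odot> y = (- 1) \<odot> u \<oplus> (u \<oplus> c \<odot> y) \<oplus> (- c') \<odot> y"
    proof -
      have "(- 1) \<odot> u \<oplus> (u \<oplus> c \<odot> y) = c \<odot> y"
        using that(1) U_in y by (simp add: M.a_comm[of "(- 1) \<odot> u"] flip: M.a_assoc)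
      then show ?thesis using y add_smult[of y c "- c'"] by simp
    qed
    also have "\<dots> = (- 1) \<odot> u \<oplus> u' \<oplus> (c' \<odot> y \<oplus> (- c') \<odot> y)"
      using that U_in y by (simp add: M.a_assoc)
    also have "c' \<odot> y \<oplus> (- c') \<odot> y = \<zero>"
      using y by (simp flip: add_smult)
    finally have "(c - c') \<odot> y \<in> U"
      using that U_props U_in by simp
    then have "(1 / (c - c')) \<odot> ((c - c') \<odot> y) \<in> U" by (rule U_props(4))
    then show False using y yU \<open>c \<noteq> c'\<close> by (simp add: smult_smult)
  qed
  define \<phi> where "\<phi> v = (THE c. \<exists>u\<in>U. v = u \<oplus> c \<odot> y)" for v
  have \<phi>: "\<phi> (u \<oplus> c \<odot> y) = c" if "u \<in> U" for u c
    unfolding \<phi>_def using that unique by (intro the_equality) blast+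
  have "\<phi> \<in> linear_maps V scalars"
  proof (rule linearI)
    fix v v' assume "v \<in> carrier V" "v' \<in> carrier V"
    then obtain c u c' u' where v: "u \<in> U" "v = u \<oplus> c \<odot> y" "u' \<in> U" "v' = u' \<oplus> c' \<odot> y"
      using ex by meson
    then have "v \<oplus> v' = (u \<oplus> u') \<oplus> (c + c') \<odot> y"
      using U_in y by (simp add: add_smult M.a_ac)
    then show "\<phi> (v \<oplus> v') = \<phi> v \<oplus>\<^bsub>scalars\<^esub> \<phi> v'"
      using v U_props(3) by (simp add: \<phi>)
  next
    fix a v assume "v \<in> carrier V"
    then obtain c u where v: "u \<in> U" "v = u \<oplus> c \<odot> y" using ex by meson
    then have "a \<odot> v = a \<odot> u \<oplus> (a * c) \<odot> y"
      using U_in y by (simp add: smult_add smult_smult)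
    then show "\<phi> (a \<odot> v) = a \<odot>\<^bsub>scalars\<^esub> \<phi> v"
      using v U_props(4) by (simp add: \<phi>)
  qed auto
  then have "restrict \<phi> (carrier V) \<in> carrier (dual_space V)" by (rule restrict_dual)
  moreover have "\<phi> w = 0" if "w \<in> W" for w
    using \<phi>[of w 0] that WU U_in y by auto
  moreover have "\<phi> y = 1"
    using \<phi>[of \<zero> 1] U_props(2) y by simp
  ultimately show ?thesis
    using that[of "restrict \<phi> (carrier V)"] y subspaceD(1)[OF W] by (simp add: subset_iff)
qed

text \<open>This is how an identity in \<open>A\<^sup>2\<close> is recovered from the relators, of which there is one family for
  each functional on \<open>A\<^sup>2\<close>.\<close>

lemma (in cspace) zero_if_functionals_vanish:
  assumes "y \<in> carrier V" "\<And>\<phi>. \<phi> \<in> carrier (dual_space V) \<Longrightarrow> \<phi> y = 0"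
  shows "y = \<zero>"
proof (rule ccontr)
  assume "y \<noteq> \<zero>"
  have "LinearCombinations.submodule class_ring {\<zero>} V" by (rule subspaceI) auto
  with \<open>y \<noteq> \<zero>\<close> assms(1) obtain \<phi> where "\<phi> \<in> carrier (dual_space V)" "\<phi> y = 1"
    by (auto elim: separating_functional)
  then show False using assms(2)[of \<phi>] by simp
qed

text \<open>Coordinates with respect to a basis are linear because they are unique.\<close>

lemma (in cspace) coordinate_expansion:
  assumes "fin_dim"
  obtains n :: nat and e \<epsilon> where
    "e \<in> {..<n} \<rightarrow> carrier V" "\<epsilon> \<in> {..<n} \<rightarrow> carrier (dual_space V)"
    "\<And>v. v \<in> carrier V \<Longrightarrow> v = (\<Oplus>i\<in>{..<n}. \<epsilon> i v \<odot> e i)"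
proof -
  obtain B where B: "finite B" "basis B" using finite_basis_exists[OF assms] by auto
  have BV: "B \<subseteq> carrier V" using B(2) by (simp add: basis_def)
  have ex1: "\<exists>!a. a \<in> B \<rightarrow>\<^sub>E UNIV \<and> lincomb a B = v" if "v \<in> carrier V" for v
    using basis_criterion[OF B(1) BV] B(2) that by simp
  define \<kappa> where "\<kappa> v = (THE a. a \<in> B \<rightarrow>\<^sub>E UNIV \<and> lincomb a B = v)" for v
  have \<kappa>: "\<kappa> v \<in> B \<rightarrow>\<^sub>E UNIV" "lincomb (\<kappa> v) B = v" if "v \<in> carrier V" for v
    using theI'[OF ex1[OF that]] unfolding \<kappa>_def by auto
  have \<kappa>_eq: "\<kappa> v b = a b" if "v \<in> carrier V" "lincomb a B = v" "b \<in> B" for v a b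
  proof -
    have "lincomb (restrict a B) B = lincomb a B"
      using BV by (intro lincomb_cong) auto
    then have "\<kappa> v = restrict a B"
      using ex1[OF that(1)] \<kappa>[OF that(1)] that(2) by auto
    then show ?thesis using that(3) by simp
  qed
  have \<epsilon>: "(\<lambda>v\<in>carrier V. \<kappa> v b) \<in> carrier (dual_space V)" if "b \<in> B" for b
  proof (rule restrict_dual, rule linearI)
    fix v w assume v: "v \<in> carrier V" and w: "w \<in> carrier V"
    have "lincomb (\<lambda>b. \<kappa> v b + \<kappa> w b) B = lincomb (\<kappa> v) B \<oplus> lincomb (\<kappa> w) B"
      unfolding lincomb_def using BV
      by (subst M.finsum_addf[symmetric]) (auto simp: add_smult intro!: M.finsum_cong')
    then have "lincomb (\<lambda>b. \<kappa> v b + \<kappa> w b) B = v \<oplus> w"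
      using \<kappa>(2) v w by simp
    from \<kappa>_eq[OF _ this that] v w
    show "\<kappa> (v \<oplus> w) b = \<kappa> v b \<oplus>\<^bsub>scalars\<^esub> \<kappa> w b" by simp
  next
    fix c v assume v: "v \<in> carrier V"
    have "lincomb (\<lambda>b. c * \<kappa> v b) B = c \<odot> lincomb (\<kappa> v) B"
      using lincomb_smult[OF BV, of "\<kappa> v" c] by simp
    then have "lincomb (\<lambda>b. c * \<kappa> v b) B = c \<odot> v"
      using \<kappa>(2) v by simp
    from \<kappa>_eq[OF _ this that] v
    show "\<kappa> (c \<odot> v) b = c \<odot>\<^bsub>scalars\<^esub> \<kappa> v b" by simp
  qed simp
  obtain e where e: "bij_betw e {0..<card B} B" using ex_bij_betw_nat_finite[OF B(1)] by auto
  then have e': "inj_on e {..<card B}" "e ` {..<card B} = B"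
    by (auto simp: bij_betw_def atLeast0LessThan)
  show ?thesis
  proof (rule that[of e "card B" "\<lambda>i. \<lambda>v\<in>carrier V. \<kappa> v (e i)"])
    show "e \<in> {..<card B} \<rightarrow> carrier V" using e' BV by auto
    show "(\<lambda>i. \<lambda>v\<in>carrier V. \<kappa> v (e i)) \<in> {..<card B} \<rightarrow> carrier (dual_space V)"
      using e' \<epsilon> by auto
    fix v assume v: "v \<in> carrier V"
    have "v = (\<Oplus>b\<in>e ` {..<card B}. \<kappa> v b \<odot> b)"
      using \<kappa>(2)[OF v] by (simp add: lincomb_def e')
    also have "\<dots> = (\<Oplus>i\<in>{..<card B}. \<kappa> v (e i) \<odot> e i)"
      using e' BV by (intro M.finsum_reindex) auto
    finally show "v = (\<Oplus>i\<in>{..<card B}. (\<lambda>v\<in>carrier V. \<kappa> v (e i)) v \<odot> e i)"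
      using v by simp
  qed
qed

text \<open>A finite-dimensional space is reflexive: by the expansion, a functional \<open>G\<close> on the dual
  is evaluation at \<open>\<Sum>\<^sub>i G(\<epsilon>\<^sub>i) e\<^sub>i\<close>.\<close>

lemma (in cspace) functional_on_dual_is_evaluation:
  assumes "fin_dim" and G: "G \<in> linear_maps (dual_space V) scalars"
  shows "\<exists>a\<in>carrier V. \<forall>u\<in>carrier (dual_space V). G u = u a"
proof -
  obtain n :: nat and e \<epsilon> where
    e: "e \<in> {..<n} \<rightarrow> carrier V" and \<epsilon>: "\<epsilon> \<in> {..<n} \<rightarrow> carrier (dual_space V)" and
    exp: "\<And>v. v \<in> carrier V \<Longrightarrow> v = (\<Oplus>i\<in>{..<n}. \<epsilon> i v \<odot> e i)"
    by (rule coordinate_expansion[OF assms(1)]) (rule that)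
  interpret D: cspace "dual_space V" by (rule cspace_dual)
  let ?a = "\<Oplus>i\<in>{..<n}. G (\<epsilon> i) \<odot> e i"
  show ?thesis
  proof (intro bexI ballI)
    show "?a \<in> carrier V" using e by (auto intro!: M.finsum_closed)
    fix u assume u: "u \<in> carrier (dual_space V)"
    have u_sum: "u (\<Oplus>i\<in>{..<n}. c i \<odot> e i) = (\<Sum>i<n. c i * u (e i))" for c
      using e u functional_finsum[OF cspace_V dualD(1)[OF u], of "{..<n}" "\<lambda>i. c i \<odot> e i"]
      by (simp add: Pi_iff dualD[OF u])
    let ?u = "\<Oplus>\<^bsub>dual_space V\<^esub>i\<in>{..<n}. u (e i) \<odot>\<^bsub>dual_space V\<^esub> \<epsilon> i"
    have \<epsilon>u: "(\<lambda>i. u (e i) \<odot>\<^bsub>dual_space V\<^esub> \<epsilon> i) \<in> {..<n} \<rightarrow> carrier (dual_space V)"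
      using \<epsilon> by auto
    have "?u \<in> carrier (dual_space V)" using \<epsilon>u by (rule D.M.finsum_closed)
    moreover have "?u v = u v" if v: "v \<in> carrier V" for v
    proof -
      have "?u v = (\<Sum>i<n. u (e i) * \<epsilon> i v)"
        using functional_finsum[OF D.cspace_V evaluation_linear[OF v] _ \<epsilon>u] v
        by (simp add: dual_ops)
      also have "\<dots> = u v"
        using arg_cong[OF exp[OF v], of u] by (simp add: u_sum mult.commute)
      finally show ?thesis .
    qed
    ultimately have "?u = u"
      using dualD(2)[of ?u V] dualD(2)[OF u] by (intro extensionalityI) auto
    then have "G u = G ?u" by simp
    also have "\<dots> = (\<Sum>i<n. u (e i) * G (\<epsilon> i))"
      using functional_finsum[OF D.cspace_V G _ \<epsilon>u] \<epsilon> linearD(3)[OF G] by (simp add: Pi_iff)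
    finally show "G u = u ?a" by (simp add: u_sum mult.commute)
  qed
qed

text \<open>An alternating form \<open>\<omega>\<close> equals \<open>\<Sum>\<^sub>i \<epsilon>\<^sub>i \<and> \<omega>(e\<^sub>i, -)/2\<close>. The factor one half appears
  because expanding either argument of \<open>\<omega>\<close> reproduces \<open>\<omega>\<close>.\<close>

lemma (in cspace) alternating_form_decomposition:
  assumes "fin_dim"
    and right: "\<And>a. a \<in> carrier V \<Longrightarrow> \<omega> a \<in> linear_maps V scalars"
    and alt: "\<And>a b. a \<in> carrier V \<Longrightarrow> b \<in> carrier V \<Longrightarrow> \<omega> b a = - \<omega> a b"
  shows "\<exists>(n :: nat) u v. u \<in> {..<n} \<rightarrow> carrier (dual_space V) \<and>
    v \<in> {..<n} \<rightarrow> carrier (dual_space V) \<and>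
    (\<forall>a\<in>carrier V. \<forall>b\<in>carrier V. \<omega> a b = (\<Sum>k<n. u k a * v k b - u k b * v k a))"
proof -
  obtain n :: nat and e \<epsilon> where
    e: "e \<in> {..<n} \<rightarrow> carrier V" and \<epsilon>: "\<epsilon> \<in> {..<n} \<rightarrow> carrier (dual_space V)" and
    exp: "\<And>v. v \<in> carrier V \<Longrightarrow> v = (\<Oplus>i\<in>{..<n}. \<epsilon> i v \<odot> e i)"
    by (rule coordinate_expansion[OF assms(1)]) (rule that)
  have expand: "\<omega> a b = (\<Sum>i<n. \<epsilon> i b * \<omega> a (e i))" if "a \<in> carrier V" "b \<in> carrier V" for a b
  proof -
    have "\<omega> a b = \<omega> a (\<Oplus>i\<in>{..<n}. \<epsilon> i b \<odot> e i)" using exp[OF that(2)] by simp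
    also have "\<dots> = (\<Sum>i<n. \<epsilon> i b * \<omega> a (e i))"
      using functional_finsum[OF cspace_V right[OF that(1)], of "{..<n}" "\<lambda>i. \<epsilon> i b \<odot> e i"] e
      by (simp add: Pi_iff linearD(3)[OF right[OF that(1)]])
    finally show ?thesis .
  qed
  show ?thesis
  proof (rule exI[of _ n], rule exI[of _ \<epsilon>],
      rule exI[of _ "\<lambda>i. \<lambda>b\<in>carrier V. 1 / 2 * \<omega> (e i) b"], intro conjI ballI)
    show "(\<lambda>i. \<lambda>b\<in>carrier V. 1 / 2 * \<omega> (e i) b) \<in> {..<n} \<rightarrow> carrier (dual_space V)"
      using e by (auto intro!: restrict_dual linearI simp: Pi_iff linearD[OF right] algebra_simps)
    fix a b assume ab: "a \<in> carrier V" "b \<in> carrier V"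
    have "(\<Sum>k<n. \<epsilon> k a * (1 / 2 * \<omega> (e k) b) - \<epsilon> k b * (1 / 2 * \<omega> (e k) a)) =
        (\<Sum>k<n. - (1 / 2) * (\<epsilon> k a * \<omega> b (e k)) + 1 / 2 * (\<epsilon> k b * \<omega> a (e k)))"
      using e ab by (intro sum.cong) (auto simp: Pi_iff alt[of _ "e _"])
    also have "\<dots> = - (1 / 2) * \<omega> b a + 1 / 2 * \<omega> a b"
      by (simp only: sum.distrib sum_distrib_left[symmetric] expand ab)
    also have "\<dots> = \<omega> a b" using alt[of a b] ab by simp
    finally show "\<omega> a b = (\<Sum>k<n. \<epsilon> k a * (\<lambda>b\<in>carrier V. 1 / 2 * \<omega> (e k) b) b -
        \<epsilon> k b * (\<lambda>b\<in>carrier V. 1 / 2 * \<omega> (e k) b) a)" using ab by simp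
  qed (fact \<epsilon>)
qed

section \<open>Bilinear algebras, ideals and quotients\<close>

locale bilinear_algebra = cspace L for L :: "'a bracket_algebra" (structure) +
  assumes bracket_closed [simp, intro]:
      "x \<in> carrier L \<Longrightarrow> y \<in> carrier L \<Longrightarrow> bracket L x y \<in> carrier L"
    and bracket_add_left: "x \<in> carrier L \<Longrightarrow> y \<in> carrier L \<Longrightarrow> z \<in> carrier L \<Longrightarrow>
      bracket L (x \<oplus> y) z = bracket L x z \<oplus> bracket L y z"
    and bracket_add_right: "x \<in> carrier L \<Longrightarrow> y \<in> carrier L \<Longrightarrow> z \<in> carrier L \<Longrightarrow>
      bracket L x (y \<oplus> z) = bracket L x y \<oplus> bracket L x z"
    and bracket_smult_left: "x \<in> carrier L \<Longrightarrow> y \<in> carrier L \<Longrightarrow>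
      bracket L (c \<odot> x) y = c \<odot> bracket L x y"
    and bracket_smult_right: "x \<in> carrier L \<Longrightarrow> y \<in> carrier L \<Longrightarrow>
      bracket L x (c \<odot> y) = c \<odot> bracket L x y"
begin

lemma bracket_zero [simp]:
  assumes "x \<in> carrier L"
  shows "bracket L \<zero> x = \<zero>" "bracket L x \<zero> = \<zero>"
  using bracket_smult_left[of \<zero> x 0] bracket_smult_right[of x \<zero> 0] assms by simp_all

lemma bilinear_algebra_L: "bilinear_algebra L" ..

end

locale lie_algebra = bilinear_algebra +
  assumes bracket_self: "x \<in> carrier L \<Longrightarrow> bracket L x x = \<zero>"
    and jacobi: "x \<in> carrier L \<Longrightarrow> y \<in> carrier L \<Longrightarrow> z \<in> carrier L \<Longrightarrow>
      bracket L x (bracket L y z) \<oplus> bracket L y (bracket L z x) \<oplus> bracket L z (bracket L x y) = \<zero>"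

definition subalgebra :: "'a set \<Rightarrow> 'a bracket_algebra \<Rightarrow> bool" where
  "subalgebra N L \<longleftrightarrow> LinearCombinations.submodule class_ring N L \<and>
     (\<forall>x\<in>N. \<forall>y\<in>N. bracket L x y \<in> N)"

lemma lie_homI:
  assumes "f \<in> linear_maps L M"
    and "\<And>x y. x \<in> carrier L \<Longrightarrow> y \<in> carrier L \<Longrightarrow> f (bracket L x y) = bracket M (f x) (f y)"
  shows "f \<in> lie_hom L M"
  using assms by (simp add: lie_hom_def)

lemma lie_homD:
  assumes "f \<in> lie_hom L M"
  shows "f \<in> linear_maps L M"
    and "\<And>x. x \<in> carrier L \<Longrightarrow> f x \<in> carrier M"
    and "\<And>x y. x \<in> carrier L \<Longrightarrow> y \<in> carrier L \<Longrightarrow> f (x \<oplus>\<^bsub>L\<^esub> y) = f x \<oplus>\<^bsub>M\<^esub> f y"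
    and "\<And>c x. x \<in> carrier L \<Longrightarrow> f (c \<odot>\<^bsub>L\<^esub> x) = c \<odot>\<^bsub>M\<^esub> f x"
    and "\<And>x y. x \<in> carrier L \<Longrightarrow> y \<in> carrier L \<Longrightarrow> f (bracket L x y) = bracket M (f x) (f y)"
  using assms linearD[of f L M] by (simp_all add: lie_hom_def)

lemma lie_hom_comp:
  assumes "f \<in> lie_hom L M" "g \<in> lie_hom M N"
  shows "(\<lambda>x. g (f x)) \<in> lie_hom L N"
  using lie_homD[OF assms(1)] lie_homD[OF assms(2)] by (intro lie_homI linearI) auto

lemma lie_hom_zero:
  assumes "bilinear_algebra L" "bilinear_algebra M" "f \<in> lie_hom L M"
  shows "f \<zero>\<^bsub>L\<^esub> = \<zero>\<^bsub>M\<^esub>"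
  using assms linear_zero lie_homD(1) unfolding bilinear_algebra_def by blast

lemma lie_hom_preimage_subalgebra:
  assumes "bilinear_algebra L" "bilinear_algebra M" "f \<in> lie_hom L M" "subalgebra N M"
  shows "subalgebra {x \<in> carrier L. f x \<in> N} L"
proof -
  interpret L: bilinear_algebra L by fact
  have N: "LinearCombinations.submodule class_ring N M" using assms(4) by (simp add: subalgebra_def)
  show ?thesis
    using assms(4) lie_homD[OF assms(3)] subspaceD[OF N] lie_hom_zero[OF assms(1-3)]
    by (auto simp: subalgebra_def intro!: L.subspaceI)
qed

lemma lie_hom_image_subalgebra:
  assumes "bilinear_algebra L" "bilinear_algebra M" "f \<in> lie_hom L M"
  shows "subalgebra (f ` carrier L) M"
proof -
  interpret L: bilinear_algebra L by fact
  interpret M: bilinear_algebra M by fact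
  note f = lie_homD[OF assms(3)]
  show ?thesis unfolding subalgebra_def
  proof (intro conjI ballI M.subspaceI)
    show "f ` carrier L \<subseteq> carrier M" using f by auto
    show "\<zero>\<^bsub>M\<^esub> \<in> f ` carrier L"
      using lie_hom_zero[OF assms] by (auto intro!: image_eqI[of _ _ "\<zero>\<^bsub>L\<^esub>"])
    fix x y assume "x \<in> f ` carrier L" "y \<in> f ` carrier L"
    then obtain x' y' where "x = f x'" "y = f y'" "x' \<in> carrier L" "y' \<in> carrier L" by auto
    then show "x \<oplus>\<^bsub>M\<^esub> y \<in> f ` carrier L" "bracket M x y \<in> f ` carrier L"
      using f(3,5)[symmetric] by auto
  next
    fix c x assume "x \<in> f ` carrier L"
    then show "c \<odot>\<^bsub>M\<^esub> x \<in> f ` carrier L" using f(4)[symmetric] by auto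
  qed
qed

lemma bracket_idealD:
  assumes "bracket_ideal I L"
  shows "LinearCombinations.submodule class_ring I L"
    and "\<And>x y. x \<in> carrier L \<Longrightarrow> y \<in> I \<Longrightarrow> bracket L x y \<in> I"
    and "\<And>x y. x \<in> I \<Longrightarrow> y \<in> carrier L \<Longrightarrow> bracket L x y \<in> I"
  using assms by (auto simp: bracket_ideal_def)

lemma (in bilinear_algebra) kernel_ideal:
  assumes "bilinear_algebra M" "f \<in> lie_hom L M"
  shows "bracket_ideal {x \<in> carrier L. f x = \<zero>\<^bsub>M\<^esub>} L"
proof -
  interpret M: bilinear_algebra M by fact
  show ?thesis
    unfolding bracket_ideal_def
    using lie_homD[OF assms(2)] lie_hom_zero[OF bilinear_algebra_L assms]
    by (intro conjI ballI subspaceI) auto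
qed

lemma (in bilinear_algebra) generated_ideal_ideal:
  assumes "S \<subseteq> carrier L"
  shows "bracket_ideal (generated_ideal L S) L"
proof -
  have top: "bracket_ideal (carrier L) L" unfolding bracket_ideal_def by (auto intro: subspaceI)
  show ?thesis unfolding bracket_ideal_def
  proof (intro conjI ballI subspaceI)
    show "generated_ideal L S \<subseteq> carrier L" unfolding generated_ideal_def using top assms by auto
  qed (auto simp: generated_ideal_def bracket_idealD(2,3)
         subspaceD(2-4)[OF bracket_idealD(1)])
qed

lemma generated_ideal_superset: "S \<subseteq> generated_ideal L S"
  by (auto simp: generated_ideal_def)

text \<open>The kernel is itself one of the ideals that are intersected.\<close>

lemma (in bilinear_algebra) generated_ideal_in_kernel:
  assumes "bilinear_algebra M" "f \<in> lie_hom L M" "S \<subseteq> carrier L" "\<And>s. s \<in> S \<Longrightarrow> f s = \<zero>\<^bsub>M\<^esub>"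
    and "x \<in> generated_ideal L S"
  shows "f x = \<zero>\<^bsub>M\<^esub>"
  using kernel_ideal[OF assms(1,2)] assms(3-5) unfolding generated_ideal_def by blast

locale algebra_ideal = bilinear_algebra +
  fixes I
  assumes ideal: "bracket_ideal I L"
begin

abbreviation proj :: "'a \<Rightarrow> 'a set" where "proj x \<equiv> I +> x"
abbreviation quot :: "'a set bracket_algebra" where "quot \<equiv> quotient_algebra L I"

lemmas I_props = subspaceD[OF bracket_idealD(1)[OF ideal]] bracket_idealD(2,3)[OF ideal]

lemma I_in [simp]: "x \<in> I \<Longrightarrow> x \<in> carrier L"
  using I_props(1) by auto

lemma abelian_subgroup_I: "abelian_subgroup I L"
proof (rule abelian_subgroupI3)
  show "additive_subgroup I L"
  proof (rule additive_subgroup.intro, rule M.add.subgroupI)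
    show "\<ominus> a \<in> I" if "a \<in> I" for a
      using that I_props(4)[of a "- 1"] by (simp add: minus_smult)
  qed (use I_props in auto)
qed (rule M.abelian_group_axioms)

lemmas coset_self = abelian_subgroup.a_rcos_self[OF abelian_subgroup_I]
lemmas coset_sum = abelian_subgroup.a_rcos_sum[OF abelian_subgroup_I]
lemmas coset_eq = abelian_subgroup.a_repr_independence'[OF abelian_subgroup_I]
lemmas mem_coset = abelian_subgroup.a_rcos_module[OF abelian_subgroup_I]

lemma proj_eq_iff:
  assumes "x \<in> carrier L" "y \<in> carrier L"
  shows "proj x = proj y \<longleftrightarrow> x \<oplus> (- 1) \<odot> y \<in> I"
proof -
  have "x \<oplus> (- 1) \<odot> y \<in> I \<longleftrightarrow> x \<in> proj y"
    using mem_coset[OF assms(2,1)] assms by (simp add: minus_smult)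
  then show ?thesis
    using assms coset_self coset_eq by blast
qed

lemma proj_eqI: "x \<in> carrier L \<Longrightarrow> i \<in> I \<Longrightarrow> proj (i \<oplus> x) = proj x"
  by (subst proj_eq_iff) (auto simp: M.a_assoc)

lemma in_proj: "x' \<in> proj x \<longleftrightarrow> (\<exists>i\<in>I. x' = i \<oplus> x)"
  by (auto simp: a_r_coset_def')

lemma self_in_proj: "x \<in> carrier L \<Longrightarrow> x \<in> proj x"
  using coset_self by simp

lemma carrier_quot: "carrier quot = proj ` carrier L"
  by (auto simp: quotient_algebra_def A_RCOSETS_def')

lemma add_quot:
  "x \<in> carrier L \<Longrightarrow> y \<in> carrier L \<Longrightarrow> proj x \<oplus>\<^bsub>quot\<^esub> proj y = proj (x \<oplus> y)"
  by (simp add: quotient_algebra_def coset_sum)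

lemma zero_quot: "\<zero>\<^bsub>quot\<^esub> = proj \<zero>"
  using I_props(1) by (simp add: quotient_algebra_def)

lemma smult_quot:
  assumes "x \<in> carrier L"
  shows "c \<odot>\<^bsub>quot\<^esub> proj x = proj (c \<odot> x)"
proof -
  have "proj (c \<odot> x') = proj (c \<odot> x)" if x': "x' \<in> proj x" for x'
  proof -
    obtain i where i: "i \<in> I" "x' = i \<oplus> x" using x' by (auto simp: in_proj)
    then have "c \<odot> x' = c \<odot> i \<oplus> c \<odot> x" using assms by (simp add: smult_add)
    then show ?thesis using proj_eqI[of "c \<odot> x" "c \<odot> i"] i I_props(4) assms by simp
  qed
  then have "c \<odot>\<^bsub>quot\<^esub> proj x = (\<Union>x'\<in>proj x. proj (c \<odot> x))"
    unfolding quotient_algebra_def by (simp cong: SUP_cong)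
  then show ?thesis
    using self_in_proj[OF assms] by auto
qed

text \<open>Two representatives change the bracket by \<open>[i, y'] + [x, j]\<close> with \<open>i\<close> and \<open>j\<close> in the ideal, which
  requires the ideal to be two-sided. The quotient bracket is therefore a union of equal cosets.\<close>

lemma bracket_quot:
  assumes "x \<in> carrier L" "y \<in> carrier L"
  shows "bracket quot (proj x) (proj y) = proj (bracket L x y)"
proof -
  have "proj (bracket L x' y') = proj (bracket L x y)" if xy: "x' \<in> proj x" "y' \<in> proj y" for x' y'
  proof -
    obtain i j where ij: "i \<in> I" "j \<in> I" "x' = i \<oplus> x" "y' = j \<oplus> y" using xy by (auto simp: in_proj)
    have "bracket L x' y' = (bracket L i y' \<oplus> bracket L x j) \<oplus> bracket L x y"
      using ij assms by (simp add: bracket_add_left bracket_add_right M.a_ac)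
    moreover have "bracket L i y' \<oplus> bracket L x j \<in> I"
      using ij assms I_props by simp
    ultimately show ?thesis using assms proj_eqI by simp
  qed
  then have "bracket quot (proj x) (proj y) = (\<Union>x'\<in>proj x. \<Union>y'\<in>proj y. proj (bracket L x y))"
    unfolding quotient_algebra_def by (simp cong: SUP_cong)
  then show ?thesis
    using self_in_proj[OF assms(1)] self_in_proj[OF assms(2)] by auto
qed

lemma bilinear_algebra_quot: "bilinear_algebra quot"
proof (intro bilinear_algebra.intro bilinear_algebra_axioms.intro)
  show "cspace quot"
  proof (rule cspaceI)
    fix X Y Z assume "X \<in> carrier quot" "Y \<in> carrier quot" "Z \<in> carrier quot"
    then obtain x y z where "x \<in> carrier L" "y \<in> carrier L" "z \<in> carrier L"
      and "X = proj x" "Y = proj y" "Z = proj z" by (auto simp: carrier_quot)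
    then show "(X \<oplus>\<^bsub>quot\<^esub> Y) \<oplus>\<^bsub>quot\<^esub> Z = X \<oplus>\<^bsub>quot\<^esub> (Y \<oplus>\<^bsub>quot\<^esub> Z)"
      and "X \<oplus>\<^bsub>quot\<^esub> Y = Y \<oplus>\<^bsub>quot\<^esub> X"
      by (simp_all add: add_quot M.a_ac)
  qed (auto simp: carrier_quot zero_quot add_quot smult_quot add_smult smult_add smult_smult)
qed (auto simp: carrier_quot add_quot smult_quot bracket_quot
       bracket_add_left bracket_add_right bracket_smult_left bracket_smult_right)

lemma proj_hom: "proj \<in> lie_hom L quot"
  by (intro lie_homI linearI) (auto simp: carrier_quot add_quot smult_quot bracket_quot)

lemma proj_zero_iff: "x \<in> carrier L \<Longrightarrow> proj x = \<zero>\<^bsub>quot\<^esub> \<longleftrightarrow> x \<in> I"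
  unfolding zero_quot by (subst proj_eq_iff) auto

text \<open>A coset may be evaluated at any representative, since two of them differ by an element of \<open>I\<close>.\<close>

lemma hom_factors:
  assumes "bilinear_algebra M" "f \<in> lie_hom L M" "\<And>x. x \<in> I \<Longrightarrow> f x = \<zero>\<^bsub>M\<^esub>"
  shows "\<exists>g\<in>lie_hom quot M. \<forall>x\<in>carrier L. g (proj x) = f x"
proof -
  interpret M: bilinear_algebra M by fact
  note f = lie_homD[OF assms(2)]
  define g where "g X = f (SOME x. x \<in> carrier L \<and> proj x = X)" for X
  have g: "g (proj x) = f x" if x: "x \<in> carrier L" for x
  proof -
    define y where "y = (SOME y. y \<in> carrier L \<and> proj y = proj x)"
    have "y \<in> carrier L \<and> proj y = proj x" unfolding y_def using x by (intro someI) auto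
    then have y: "y \<in> carrier L" "y \<oplus> (- 1) \<odot> x \<in> I" using proj_eq_iff[of y x] x by auto
    then have "f y \<oplus>\<^bsub>M\<^esub> (- 1) \<odot>\<^bsub>M\<^esub> f x = \<zero>\<^bsub>M\<^esub>"
      using assms(3)[OF y(2)] x by (simp add: f)
    then have "f y = f x" using f(2) x y M.eq_if_diff_zero[of "f y" "f x"] by simp
    then show ?thesis by (simp add: g_def y_def)
  qed
  have "g \<in> lie_hom quot M"
    by (intro lie_homI linearI)
      (auto simp: carrier_quot add_quot smult_quot bracket_quot g f)
  then show ?thesis using g by blast
qed

end

section \<open>The free nonassociative algebra\<close>

lemma free_nonassoc_simps:
  "carrier (free_nonassoc X) = {p. finite {w. p w \<noteq> 0} \<and> (\<forall>w. p w \<noteq> 0 \<longrightarrow> set_magma w \<subseteq> X)}"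
  "zero (free_nonassoc X) = (\<lambda>w. 0)"
  "add (free_nonassoc X) p q = (\<lambda>w. p w + q w)"
  "smult (free_nonassoc X) c p = (\<lambda>w. c * p w)"
  "bracket (free_nonassoc X) p q = (\<lambda>w. case w of Gen x \<Rightarrow> 0 | Br s t \<Rightarrow> p s * q t)"
  by (simp_all add: free_nonassoc_def)

definition monomial :: "'x magma \<Rightarrow> 'x magma \<Rightarrow> complex" where
  "monomial w = (\<lambda>v. if v = w then 1 else 0)"

lemma generator_monomial: "generator x = monomial (Gen x)"
  by (simp add: generator_def monomial_def)

lemma monomial_carrier: "set_magma w \<subseteq> X \<Longrightarrow> monomial w \<in> carrier (free_nonassoc X)"
  by (auto simp: free_nonassoc_simps monomial_def)

lemma generator_carrier: "x \<in> X \<Longrightarrow> generator x \<in> carrier (free_nonassoc X)"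
  by (simp add: generator_monomial monomial_carrier)

lemma bracket_monomial:
  "bracket (free_nonassoc X) (monomial s) (monomial t) = monomial (Br s t)"
  by (auto simp: free_nonassoc_simps monomial_def fun_eq_iff split: magma.split)

lemma free_nonassoc_carrierI:
  assumes "finite S" "\<And>w. p w \<noteq> 0 \<Longrightarrow> w \<in> S" "\<And>w. p w \<noteq> 0 \<Longrightarrow> set_magma w \<subseteq> X"
  shows "p \<in> carrier (free_nonassoc X)"
proof -
  have "finite {w. p w \<noteq> 0}" by (rule finite_subset[OF _ assms(1)]) (use assms(2) in auto)
  then show ?thesis using assms(3) by (simp add: free_nonassoc_simps)
qed

lemma free_nonassoc_carrierD:
  assumes "p \<in> carrier (free_nonassoc X)"
  shows "finite {w. p w \<noteq> 0}" "\<And>w. p w \<noteq> 0 \<Longrightarrow> set_magma w \<subseteq> X"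
  using assms by (simp_all add: free_nonassoc_simps)

lemma cspace_free_nonassoc: "cspace (free_nonassoc X)"
proof (rule cspaceI)
  fix p q assume p: "p \<in> carrier (free_nonassoc X)" and q: "q \<in> carrier (free_nonassoc X)"
  show "p \<oplus>\<^bsub>free_nonassoc X\<^esub> q \<in> carrier (free_nonassoc X)"
    using free_nonassoc_carrierD[OF p] free_nonassoc_carrierD[OF q]
    by (intro free_nonassoc_carrierI[of "{w. p w \<noteq> 0} \<union> {w. q w \<noteq> 0}"])
      (simp_all add: free_nonassoc_simps, auto, (metis add_0 subsetD)?)
next
  fix c p assume p: "p \<in> carrier (free_nonassoc X)"
  show "c \<odot>\<^bsub>free_nonassoc X\<^esub> p \<in> carrier (free_nonassoc X)"
    using free_nonassoc_carrierD[OF p]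
    by (intro free_nonassoc_carrierI[of "{w. p w \<noteq> 0}"]) (simp_all add: free_nonassoc_simps)
qed (auto simp: free_nonassoc_simps algebra_simps)

lemma bilinear_algebra_free_nonassoc: "bilinear_algebra (free_nonassoc X)"
proof (intro bilinear_algebra.intro bilinear_algebra_axioms.intro cspace_free_nonassoc)
  fix p q assume p: "p \<in> carrier (free_nonassoc X)" and q: "q \<in> carrier (free_nonassoc X)"
  show "bracket (free_nonassoc X) p q \<in> carrier (free_nonassoc X)"
  proof (rule free_nonassoc_carrierI)
    show "finite ((\<lambda>(s, t). Br s t) ` ({w. p w \<noteq> 0} \<times> {w. q w \<noteq> 0}))"
      using free_nonassoc_carrierD(1)[OF p] free_nonassoc_carrierD(1)[OF q] by simp
    fix w assume w: "bracket (free_nonassoc X) p q w \<noteq> 0"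
    then obtain s t where st: "w = Br s t" "p s \<noteq> 0" "q t \<noteq> 0"
      by (cases w) (auto simp: free_nonassoc_simps)
    then show "w \<in> (\<lambda>(s, t). Br s t) ` ({w. p w \<noteq> 0} \<times> {w. q w \<noteq> 0})" by auto
    show "set_magma w \<subseteq> X"
      using st free_nonassoc_carrierD(2)[OF p] free_nonassoc_carrierD(2)[OF q] by auto
  qed
qed (auto simp: free_nonassoc_simps fun_eq_iff algebra_simps split: magma.split)

text \<open>The monomials span, so a property closed under linear combinations need only be checked
  on them.\<close>

lemma free_nonassoc_linear_induct [consumes 1, case_names zero monomial add smult]:
  assumes "p \<in> carrier (free_nonassoc X)"
    and zero: "P (\<lambda>w. 0)"
    and monomial: "\<And>w. set_magma w \<subseteq> X \<Longrightarrow> P (monomial w)"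
    and add: "\<And>p q. p \<in> carrier (free_nonassoc X) \<Longrightarrow> q \<in> carrier (free_nonassoc X) \<Longrightarrow>
      P p \<Longrightarrow> P q \<Longrightarrow> P (p \<oplus>\<^bsub>free_nonassoc X\<^esub> q)"
    and smult: "\<And>c p. p \<in> carrier (free_nonassoc X) \<Longrightarrow> P p \<Longrightarrow> P (c \<odot>\<^bsub>free_nonassoc X\<^esub> p)"
  shows "P p"
proof -
  have "finite {w. p w \<noteq> 0}" using assms(1) by (rule free_nonassoc_carrierD)
  then show ?thesis using assms(1)
  proof (induction "{w. p w \<noteq> 0}" arbitrary: p rule: finite_induct)
    case empty
    then have "p = (\<lambda>w. 0)" by auto
    then show ?case using zero by simp
  next
    case (insert v S)
    let ?q = "p(v := 0)" and ?r = "p v \<odot>\<^bsub>free_nonassoc X\<^esub> monomial v"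
    have S: "S = {w. ?q w \<noteq> 0}" using insert.hyps(2,4) by auto
    have v: "set_magma v \<subseteq> X"
      using insert.hyps(4) free_nonassoc_carrierD(2)[OF insert.prems] by auto
    have q: "?q \<in> carrier (free_nonassoc X)"
      using free_nonassoc_carrierD(2)[OF insert.prems] S insert.hyps(1)
      by (intro free_nonassoc_carrierI[of S]) (auto split: if_splits)
    have "P ?q" by (rule insert.hyps(3)[OF S q])
    moreover have "P ?r" using monomial[OF v] smult monomial_carrier[OF v] by blast
    moreover have "?r \<in> carrier (free_nonassoc X)"
      using monomial_carrier[OF v] bilinear_algebra_free_nonassoc[of X]
      by (simp add: bilinear_algebra_def cspace.smult_in)
    ultimately have "P (?q \<oplus>\<^bsub>free_nonassoc X\<^esub> ?r)" using add q by blast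
    moreover have "?q \<oplus>\<^bsub>free_nonassoc X\<^esub> ?r = p"
      by (auto simp: free_nonassoc_simps monomial_def fun_eq_iff)
    ultimately show ?case by simp
  qed
qed

text \<open>A monomial is an iterated bracket of generators.\<close>

lemma subalgebra_with_generators:
  assumes N: "subalgebra N (free_nonassoc X)" and gen: "\<And>x. x \<in> X \<Longrightarrow> generator x \<in> N"
  shows "N = carrier (free_nonassoc X)"
proof -
  have sub: "LinearCombinations.submodule class_ring N (free_nonassoc X)"
    and br: "\<And>p q. p \<in> N \<Longrightarrow> q \<in> N \<Longrightarrow> bracket (free_nonassoc X) p q \<in> N"
    using N by (auto simp: subalgebra_def)
  have mono: "monomial w \<in> N" if "set_magma w \<subseteq> X" for w
    using that
  proof (induction w)
    case (Gen x)
    then show ?case using gen by (simp add: generator_monomial)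
  next
    case (Br s t)
    then show ?case using br[of "monomial s" "monomial t"] by (simp add: bracket_monomial)
  qed
  have "p \<in> N" if "p \<in> carrier (free_nonassoc X)" for p
    using that
  proof (induction rule: free_nonassoc_linear_induct)
    case zero
    show ?case using subspaceD(2)[OF sub] by (simp add: free_nonassoc_simps)
  qed (use mono subspaceD(3,4)[OF sub] in auto)
  then show ?thesis using subspaceD(1)[OF sub] by auto
qed

primrec evaluate :: "('a, 'm) bracket_algebra_scheme \<Rightarrow> ('x \<Rightarrow> 'a) \<Rightarrow> 'x magma \<Rightarrow> 'a" where
  "evaluate M g (Gen x) = g x"
| "evaluate M g (Br s t) = bracket M (evaluate M g s) (evaluate M g t)"

text \<open>The homomorphism is the linear extension of the evaluation of bracket monomials. It respects
  brackets because it does so on monomials and both sides are bilinear.\<close>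

lemma free_nonassoc_universal:
  assumes M: "bilinear_algebra M" and g: "\<And>x. x \<in> X \<Longrightarrow> g x \<in> carrier M"
  shows "\<exists>f\<in>lie_hom (free_nonassoc X) M. \<forall>x\<in>X. f (generator x) = g x"
proof -
  interpret M: bilinear_algebra M by fact
  let ?F = "free_nonassoc X"
  interpret F: bilinear_algebra ?F by (rule bilinear_algebra_free_nonassoc)
  have ev: "evaluate M g w \<in> carrier M" if "set_magma w \<subseteq> X" for w
    using that by (induction w) (auto simp: g)
  define f where "f p = (\<Oplus>\<^bsub>M\<^esub>w\<in>{w. p w \<noteq> 0}. p w \<odot>\<^bsub>M\<^esub> evaluate M g w)" for p
  \<comment> \<open>Sums are taken over a common finite support, on which linearity is termwise.\<close>
  have f_eq: "f p = (\<Oplus>\<^bsub>M\<^esub>w\<in>S. p w \<odot>\<^bsub>M\<^esub> evaluate M g w)"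
    if "finite S" "{w. p w \<noteq> 0} \<subseteq> S" "\<And>w. w \<in> S \<Longrightarrow> set_magma w \<subseteq> X" for p S
    unfolding f_def using that ev
    by (intro M.add.finprod_mono_neutral_cong_left) auto
  have supp: "finite {w. p w \<noteq> 0}" "\<And>w. w \<in> {w. p w \<noteq> 0} \<Longrightarrow> set_magma w \<subseteq> X"
    if "p \<in> carrier ?F" for p using free_nonassoc_carrierD[OF that] by auto
  have f_lin: "f \<in> linear_maps ?F M"
  proof (rule linearI)
    fix p assume p: "p \<in> carrier ?F"
    show "f p \<in> carrier M"
      unfolding f_def using supp[OF p] ev by (intro M.M.finsum_closed) auto
    fix c
    have "f (c \<odot>\<^bsub>?F\<^esub> p) = (\<Oplus>\<^bsub>M\<^esub>w\<in>{w. p w \<noteq> 0}. c \<odot>\<^bsub>M\<^esub> (p w \<odot>\<^bsub>M\<^esub> evaluate M g w))"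
      using supp[OF p] ev
      by (subst f_eq[of "{w. p w \<noteq> 0}"])
        (auto simp: free_nonassoc_simps M.smult_smult intro!: M.M.finsum_cong')
    also have "\<dots> = c \<odot>\<^bsub>M\<^esub> f p"
      unfolding f_def using supp[OF p] ev
      by (subst M.finsum_smult_ldistr) auto
    finally show "f (c \<odot>\<^bsub>?F\<^esub> p) = c \<odot>\<^bsub>M\<^esub> f p" .
  next
    fix p q assume p: "p \<in> carrier ?F" and q: "q \<in> carrier ?F"
    let ?S = "{w. p w \<noteq> 0} \<union> {w. q w \<noteq> 0}"
    have S: "finite ?S" "\<And>w. w \<in> ?S \<Longrightarrow> set_magma w \<subseteq> X" using supp[OF p] supp[OF q] by auto
    have "f (p \<oplus>\<^bsub>?F\<^esub> q) = (\<Oplus>\<^bsub>M\<^esub>w\<in>?S. (p w + q w) \<odot>\<^bsub>M\<^esub> evaluate M g w)"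
      unfolding free_nonassoc_simps(3) by (rule f_eq[OF S(1) _ S(2)]) auto
    also have "\<dots> = (\<Oplus>\<^bsub>M\<^esub>w\<in>?S. (p w \<odot>\<^bsub>M\<^esub> evaluate M g w) \<oplus>\<^bsub>M\<^esub> (q w \<odot>\<^bsub>M\<^esub> evaluate M g w))"
      using S ev by (intro M.M.finsum_cong') (auto simp: M.add_smult)
    also have "\<dots> = (\<Oplus>\<^bsub>M\<^esub>w\<in>?S. p w \<odot>\<^bsub>M\<^esub> evaluate M g w) \<oplus>\<^bsub>M\<^esub>
        (\<Oplus>\<^bsub>M\<^esub>w\<in>?S. q w \<odot>\<^bsub>M\<^esub> evaluate M g w)"
      using S ev by (intro M.M.finsum_addf) auto
    also have "\<dots> = f p \<oplus>\<^bsub>M\<^esub> f q"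
      using f_eq[OF S(1) _ S(2), of p] f_eq[OF S(1) _ S(2), of q] by simp
    finally show "f (p \<oplus>\<^bsub>?F\<^esub> q) = f p \<oplus>\<^bsub>M\<^esub> f q" .
  qed
  note f = linearD[OF f_lin]
  have f_mono: "f (monomial w) = evaluate M g w" if "set_magma w \<subseteq> X" for w
    using that ev[OF that] f_eq[of "{w}" "monomial w"] by (simp add: monomial_def)
  have bracket_zero: "bracket M (f \<zero>\<^bsub>?F\<^esub>) x = f \<zero>\<^bsub>?F\<^esub>" "bracket M x (f \<zero>\<^bsub>?F\<^esub>) = f \<zero>\<^bsub>?F\<^esub>"
    if "x \<in> carrier M" for x
    using linear_zero[OF F.cspace_V M.cspace_V f_lin] that by simp_all
  have "f (bracket ?F p q) = bracket M (f p) (f q)" if p: "p \<in> carrier ?F" and q: "q \<in> carrier ?F" for p q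
    using p
  proof (induction rule: free_nonassoc_linear_induct)
    case zero
    show ?case using bracket_zero(1)[OF f(1)[OF q]] F.bracket_zero(1)[OF q]
      by (simp add: free_nonassoc_simps(2))
  next
    case (monomial s)
    note s = monomial monomial_carrier[OF monomial]
    show ?case using q
    proof (induction rule: free_nonassoc_linear_induct)
      case zero
      show ?case using bracket_zero(2)[OF f(1)[OF s(2)]] F.bracket_zero(2)[OF s(2)]
        by (simp add: free_nonassoc_simps(2))
    next
      case (monomial t)
      then show ?case using s(1) by (simp add: bracket_monomial f_mono)
    qed (use s(2) in \<open>simp_all add: F.bracket_add_right F.bracket_smult_right f
        M.bracket_add_right M.bracket_smult_right\<close>)
  qed (use q in \<open>simp_all add: F.bracket_add_left F.bracket_smult_left f
        M.bracket_add_left M.bracket_smult_left\<close>)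
  then have "f \<in> lie_hom ?F M" by (intro lie_homI f_lin) auto
  moreover have "\<forall>x\<in>X. f (generator x) = g x" by (simp add: generator_monomial f_mono)
  ultimately show ?thesis by blast
qed

section \<open>The free Lie algebra on a vector space\<close>

context cspace
begin

abbreviation F where "F \<equiv> free_nonassoc (carrier V)"
abbreviation R where "R \<equiv> free_lie_relations V"

lemma free_lie_relation_cases:
  assumes "r \<in> R"
  obtains
    (add) u v where "u \<in> carrier V" "v \<in> carrier V"
      "r = generator (u \<oplus> v) \<ominus>\<^bsub>F\<^esub> (generator u \<oplus>\<^bsub>F\<^esub> generator v)"
  | (smult) c u where "u \<in> carrier V" "r = generator (c \<odot> u) \<ominus>\<^bsub>F\<^esub> (c \<odot>\<^bsub>F\<^esub> generator u)"
  | (self) p where "p \<in> carrier F" "r = bracket F p p"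
  | (jacobi) p q s where "p \<in> carrier F" "q \<in> carrier F" "s \<in> carrier F"
      "r = bracket F p (bracket F q s) \<oplus>\<^bsub>F\<^esub> bracket F q (bracket F s p)
        \<oplus>\<^bsub>F\<^esub> bracket F s (bracket F p q)"
  using assms unfolding free_lie_relations_def Let_def
  apply (elim UnE CollectE exE conjE)
  subgoal by (rule add)
  subgoal by (rule smult)
  subgoal by (rule self)
  subgoal by (rule jacobi)
  done

lemma free_lie_relations_carrier: "R \<subseteq> carrier F"
proof
  interpret F: bilinear_algebra F by (rule bilinear_algebra_free_nonassoc)
  fix r assume "r \<in> R"
  then show "r \<in> carrier F"
    by (cases rule: free_lie_relation_cases) (simp_all add: generator_carrier)
qed

lemma algebra_ideal_relations: "algebra_ideal F (generated_ideal F R)"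
proof -
  interpret F: bilinear_algebra F by (rule bilinear_algebra_free_nonassoc)
  show ?thesis
    by unfold_locales (rule F.generated_ideal_ideal[OF free_lie_relations_carrier])
qed

lemma bilinear_algebra_free_lie: "bilinear_algebra (free_lie V)"
  unfolding free_lie_def by (rule algebra_ideal.bilinear_algebra_quot[OF algebra_ideal_relations])

lemma free_lie_incl_linear: "free_lie_incl V \<in> linear_maps V (free_lie V)"
proof -
  interpret F: algebra_ideal F "generated_ideal F R" by (rule algebra_ideal_relations)
  note gen = generator_carrier[of _ "carrier V"]
  have rel: "F.proj x = F.proj y" if "x \<ominus>\<^bsub>F\<^esub> y \<in> R" "x \<in> carrier F" "y \<in> carrier F" for x y
    using that generated_ideal_superset[of R F]
    by (subst F.proj_eq_iff) (auto simp: a_minus_def F.minus_smult)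
  show ?thesis
  proof (rule linearI)
    fix u assume u: "u \<in> carrier V"
    show "free_lie_incl V u \<in> carrier (free_lie V)"
      using gen[OF u] by (simp add: free_lie_incl_def free_lie_def F.carrier_quot)
    fix c
    have "F.proj (generator (c \<odot> u)) = F.proj (c \<odot>\<^bsub>F\<^esub> generator u)"
    proof (rule rel)
      show "generator (c \<odot> u) \<ominus>\<^bsub>F\<^esub> (c \<odot>\<^bsub>F\<^esub> generator u) \<in> R"
        unfolding free_lie_relations_def Let_def using u by blast
    qed (use u gen in auto)
    then show "free_lie_incl V (c \<odot> u) = c \<odot>\<^bsub>free_lie V\<^esub> free_lie_incl V u"
      using gen[OF u] by (simp add: free_lie_incl_def free_lie_def F.smult_quot)
  next
    fix u v assume u: "u \<in> carrier V" and v: "v \<in> carrier V"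
    have "F.proj (generator (u \<oplus> v)) = F.proj (generator u \<oplus>\<^bsub>F\<^esub> generator v)"
    proof (rule rel)
      show "generator (u \<oplus> v) \<ominus>\<^bsub>F\<^esub> (generator u \<oplus>\<^bsub>F\<^esub> generator v) \<in> R"
        unfolding free_lie_relations_def Let_def using u v by blast
    qed (use u v gen in auto)
    then show "free_lie_incl V (u \<oplus> v) = free_lie_incl V u \<oplus>\<^bsub>free_lie V\<^esub> free_lie_incl V v"
      using gen[OF u] gen[OF v] by (simp add: free_lie_incl_def free_lie_def F.add_quot)
  qed
qed

lemma free_lie_generated:
  assumes "subalgebra N (free_lie V)" "\<And>v. v \<in> carrier V \<Longrightarrow> free_lie_incl V v \<in> N"
  shows "N = carrier (free_lie V)"
proof -
  interpret F: algebra_ideal F "generated_ideal F R" by (rule algebra_ideal_relations)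
  have "subalgebra {x \<in> carrier F. F.proj x \<in> N} F"
    using assms(1) lie_hom_preimage_subalgebra[OF F.bilinear_algebra_L F.bilinear_algebra_quot F.proj_hom]
    by (simp add: free_lie_def)
  then have "{x \<in> carrier F. F.proj x \<in> N} = carrier F"
    using assms(2) by (intro subalgebra_with_generators) (auto simp: free_lie_incl_def generator_carrier)
  then have "carrier (free_lie V) \<subseteq> N" by (auto simp: free_lie_def F.carrier_quot)
  moreover have "N \<subseteq> carrier (free_lie V)"
    using assms(1) subspaceD(1) by (auto simp: subalgebra_def)
  ultimately show ?thesis by simp
qed

text \<open>A linear map makes the first two kinds of relations vanish, and the Lie algebra axioms of \<open>M\<close> the
  other two.\<close>

lemma free_lie_universal:
  assumes M: "lie_algebra M" and G: "G \<in> linear_maps V M"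
  shows "\<exists>f\<in>lie_hom (free_lie V) M. \<forall>v\<in>carrier V. f (free_lie_incl V v) = G v"
proof -
  interpret M: lie_algebra M by fact
  interpret F: algebra_ideal F "generated_ideal F R" by (rule algebra_ideal_relations)
  note G = linearD[OF G]
  obtain h where h_hom: "h \<in> lie_hom F M" and h_gen: "\<forall>v\<in>carrier V. h (generator v) = G v"
    using free_nonassoc_universal[of M "carrier V" G, OF M.bilinear_algebra_L G(1)] by auto
  note h = lie_homD[OF h_hom]
  have minus: "h (x \<ominus>\<^bsub>F\<^esub> y) = h x \<oplus>\<^bsub>M\<^esub> (- 1) \<odot>\<^bsub>M\<^esub> h y" if "x \<in> carrier F" "y \<in> carrier F" for x y
    using that by (simp add: a_minus_def F.minus_smult h)
  have h_rel: "h r = \<zero>\<^bsub>M\<^esub>" if "r \<in> R" for r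
    using that
    by (cases rule: free_lie_relation_cases)
      (simp_all add: minus h h_gen G M.bracket_self M.jacobi generator_carrier)
  have h_ideal: "h x = \<zero>\<^bsub>M\<^esub>" if "x \<in> generated_ideal F R" for x
    by (rule F.generated_ideal_in_kernel[OF M.bilinear_algebra_L h_hom free_lie_relations_carrier
          h_rel that])
  from F.hom_factors[OF M.bilinear_algebra_L h_hom h_ideal]
  obtain f where "f \<in> lie_hom F.quot M" "\<forall>x\<in>carrier F. f (F.proj x) = h x" by auto
  then show ?thesis
    unfolding free_lie_def free_lie_incl_def
    by (intro bexI[of _ f]) (simp_all add: generator_carrier h_gen)
qed

end

text \<open>Keeps the degree in \<open>gr A 1\<close> from being rewritten to \<open>Suc 0\<close>.\<close>

declare One_nat_def [simp del]

section \<open>The holonomy Lie algebra\<close>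

context cdga
begin

lemma cspace_gr: "cspace (gr A i)"
  using gr_vectorspace by (simp add: cspace_def)

abbreviation A\<^sub>1 where "A\<^sub>1 \<equiv> dual_space (gr A 1)"
abbreviation L where "L \<equiv> free_lie A\<^sub>1"

lemma cspace_A\<^sub>1: "cspace A\<^sub>1"
  by (rule cspace.cspace_dual[OF cspace_gr])

lemmas bilinear_algebra_L = cspace.bilinear_algebra_free_lie[OF cspace_A\<^sub>1]
lemmas incl_linear = cspace.free_lie_incl_linear[OF cspace_A\<^sub>1]

lemma diff_dual_closed:
  assumes "\<phi> \<in> carrier (dual_space (gr A 2))"
  shows "diff_dual A \<phi> \<in> carrier A\<^sub>1"
proof -
  interpret V: cspace "gr A 1" by (rule cspace_gr)
  have "gdiff A 1 \<in> linear_maps (gr A 1) (gr A 2)"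
    using gdiff_linear[of 1] by (simp only: one_add_one)
  from linearD[OF this] show ?thesis
    unfolding diff_dual_def using dualD[OF assms]
    by (intro V.restrict_dual linearI) auto
qed

text \<open>An expression of \<open>\<union>\<^sup>*\<phi>\<close> as a sum of decomposable elements. It is kept as data because the element
  of the free Lie algebra attached to \<open>\<phi>\<close> is written in terms of it.\<close>

definition decomposes :: "('a \<Rightarrow> complex) \<Rightarrow> nat \<Rightarrow> (nat \<Rightarrow> 'a \<Rightarrow> complex) \<Rightarrow> (nat \<Rightarrow> 'a \<Rightarrow> complex) \<Rightarrow> bool"
  where "decomposes \<phi> n u v \<longleftrightarrow> \<phi> \<in> carrier (dual_space (gr A 2)) \<and>
    u \<in> {..<n} \<rightarrow> carrier A\<^sub>1 \<and> v \<in> {..<n} \<rightarrow> carrier A\<^sub>1 \<and>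
    (\<forall>a\<in>carrier (gr A 1). \<forall>b\<in>carrier (gr A 1).
       cup_dual A \<phi> a b = (\<Sum>k<n. wedge A (u k) (v k) a b))"

text \<open>The expression \<open>d\<^sup>*\<phi> + \<union>\<^sup>*\<phi>\<close> with \<open>A\<^sub>1\<close> mapped to any algebra by \<open>G\<close>, so that the defining relations
  of the holonomy Lie algebra and their images under homomorphisms have the same form.\<close>

definition relator where
  "relator M G \<phi> n u v =
     G (diff_dual A \<phi>) \<oplus>\<^bsub>M\<^esub> (\<Oplus>\<^bsub>M\<^esub>k\<in>{..<n}. bracket M (G (u k)) (G (v k)))"

definition flat_maps where
  "flat_maps M = {G \<in> linear_maps A\<^sub>1 M.
     \<forall>\<phi> (n :: nat) u v. decomposes \<phi> n u v \<longrightarrow> relator M G \<phi> n u v = \<zero>\<^bsub>M\<^esub>}"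

lemma holonomy_relations_eq:
  "holonomy_relations A = {relator L (free_lie_incl A\<^sub>1) \<phi> n u v | \<phi> (n :: nat) u v. decomposes \<phi> n u v}"
  by (simp add: holonomy_relations_def relator_def decomposes_def Let_def)

lemma relator_closed:
  assumes "bilinear_algebra M" "G \<in> linear_maps A\<^sub>1 M" "decomposes \<phi> n u v"
  shows "relator M G \<phi> n u v \<in> carrier M"
proof -
  interpret M: bilinear_algebra M by fact
  show ?thesis
    using assms(3) diff_dual_closed linearD(1)[OF assms(2)]
    by (auto simp: relator_def decomposes_def Pi_iff intro!: M.M.finsum_closed)
qed

lemma relator_hom:
  assumes "bilinear_algebra M" "bilinear_algebra N" "G \<in> linear_maps A\<^sub>1 M" "f \<in> lie_hom M N"
    and "decomposes \<phi> n u v"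
  shows "f (relator M G \<phi> n u v) = relator N (\<lambda>x. f (G x)) \<phi> n u v"
proof -
  interpret M: bilinear_algebra M by fact
  interpret N: bilinear_algebra N by fact
  note f = lie_homD[OF assms(4)]
  have in_M: "G (diff_dual A \<phi>) \<in> carrier M" "(\<lambda>k. bracket M (G (u k)) (G (v k))) \<in> {..<n} \<rightarrow> carrier M"
    using assms(5) diff_dual_closed linearD(1)[OF assms(3)] by (auto simp: decomposes_def Pi_iff)
  have uv: "\<And>k. k < n \<Longrightarrow> G (u k) \<in> carrier M \<and> G (v k) \<in> carrier M"
    using assms(5) linearD(1)[OF assms(3)] by (auto simp: decomposes_def Pi_iff)
  have "f (\<Oplus>\<^bsub>M\<^esub>k\<in>{..<n}. bracket M (G (u k)) (G (v k))) =
      (\<Oplus>\<^bsub>N\<^esub>k\<in>{..<n}. f (bracket M (G (u k)) (G (v k))))"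
    by (rule linear_finsum[OF M.cspace_V N.cspace_V f(1) _ in_M(2)]) simp
  also have "\<dots> = (\<Oplus>\<^bsub>N\<^esub>k\<in>{..<n}. bracket N (f (G (u k))) (f (G (v k))))"
    using uv f(2,5) by (intro N.M.finsum_cong') auto
  finally show ?thesis
    unfolding relator_def using in_M f(3) by (simp add: M.M.finsum_closed)
qed

lemma holonomy_relations_carrier: "holonomy_relations A \<subseteq> carrier L"
  using relator_closed[OF bilinear_algebra_L incl_linear] by (auto simp: holonomy_relations_eq)

lemma algebra_ideal_holonomy: "algebra_ideal L (generated_ideal L (holonomy_relations A))"
proof -
  interpret L: bilinear_algebra L by (rule bilinear_algebra_L)
  show ?thesis
    by unfold_locales (rule L.generated_ideal_ideal[OF holonomy_relations_carrier])
qed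

lemma bilinear_algebra_holonomy: "bilinear_algebra (holonomy_lie A)"
  unfolding holonomy_lie_def Let_def
  by (rule algebra_ideal.bilinear_algebra_quot[OF algebra_ideal_holonomy])

definition holonomy_incl :: "('a \<Rightarrow> complex) \<Rightarrow> (('a \<Rightarrow> complex) magma \<Rightarrow> complex) set set" where
  "holonomy_incl u = generated_ideal L (holonomy_relations A) +>\<^bsub>L\<^esub> free_lie_incl A\<^sub>1 u"

text \<open>The holonomy Lie algebra is the universal target of a flat map: restriction to \<open>A\<^sub>1\<close>
  identifies its Lie algebra homomorphisms to \<open>M\<close> with the flat maps to \<open>M\<close>.\<close>

lemma lie_hom_flat:
  assumes M: "bilinear_algebra M" and f: "f \<in> lie_hom (holonomy_lie A) M"
  shows "(\<lambda>u. f (holonomy_incl u)) \<in> flat_maps M"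
proof -
  interpret Q: algebra_ideal L "generated_ideal L (holonomy_relations A)"
    by (rule algebra_ideal_holonomy)
  have f': "f \<in> lie_hom Q.quot M" using f by (simp add: holonomy_lie_def Let_def)
  let ?g = "\<lambda>x. f (Q.proj x)"
  have g: "?g \<in> lie_hom L M" by (rule lie_hom_comp[OF Q.proj_hom f'])
  have lin: "(\<lambda>u. f (holonomy_incl u)) \<in> linear_maps A\<^sub>1 M"
    using linearD[OF incl_linear] lie_homD[OF g] unfolding holonomy_incl_def
    by (intro linearI) auto
  have "relator M (\<lambda>u. f (holonomy_incl u)) \<phi> n u v = \<zero>\<^bsub>M\<^esub>" if d: "decomposes \<phi> n u v" for \<phi> n u v
  proof -
    let ?r = "relator L (free_lie_incl A\<^sub>1) \<phi> n u v"
    have r: "?r \<in> holonomy_relations A" using d by (auto simp: holonomy_relations_eq)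
    have "Q.proj ?r = \<zero>\<^bsub>Q.quot\<^esub>"
      using Q.proj_zero_iff[OF subsetD[OF holonomy_relations_carrier r]]
        subsetD[OF generated_ideal_superset r] by simp
    then have "?g ?r = \<zero>\<^bsub>M\<^esub>"
      using lie_hom_zero[OF Q.bilinear_algebra_quot M f'] by simp
    then show ?thesis
      using relator_hom[OF bilinear_algebra_L M incl_linear g d] by (simp add: holonomy_incl_def)
  qed
  then show ?thesis using lin by (simp add: flat_maps_def)
qed

lemma flat_map_extends:
  assumes M: "lie_algebra M" and G: "G \<in> flat_maps M"
  shows "\<exists>f\<in>lie_hom (holonomy_lie A) M. \<forall>u\<in>carrier A\<^sub>1. f (holonomy_incl u) = G u"
proof -
  interpret M: lie_algebra M by fact
  interpret Q: algebra_ideal L "generated_ideal L (holonomy_relations A)"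
    by (rule algebra_ideal_holonomy)
  have G_lin: "G \<in> linear_maps A\<^sub>1 M" using G by (simp add: flat_maps_def)
  from cspace.free_lie_universal[OF cspace_A\<^sub>1 M G_lin]
  obtain h where h: "h \<in> lie_hom L M" and "\<forall>u\<in>carrier A\<^sub>1. h (free_lie_incl A\<^sub>1 u) = G u"
    by auto
  then have hG: "\<And>u. u \<in> carrier A\<^sub>1 \<Longrightarrow> h (free_lie_incl A\<^sub>1 u) = G u" by auto
  have h_rel: "h r = \<zero>\<^bsub>M\<^esub>" if r_in: "r \<in> holonomy_relations A" for r
  proof -
    obtain \<phi> n u v where r: "r = relator L (free_lie_incl A\<^sub>1) \<phi> n u v" and d: "decomposes \<phi> n u v"
      using r_in by (auto simp: holonomy_relations_eq)
    have uv: "u k \<in> carrier A\<^sub>1" "v k \<in> carrier A\<^sub>1" if "k < n" for k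
      using d that by (auto simp: decomposes_def)
    have \<phi>: "diff_dual A \<phi> \<in> carrier A\<^sub>1" using d diff_dual_closed by (simp add: decomposes_def)
    have "h r = relator M (\<lambda>u. h (free_lie_incl A\<^sub>1 u)) \<phi> n u v"
      unfolding r by (rule relator_hom[OF bilinear_algebra_L M.bilinear_algebra_L incl_linear h d])
    also have "\<dots> = relator M G \<phi> n u v"
      unfolding relator_def hG[OF \<phi>] using hG uv linearD(1)[OF G_lin]
      by (intro arg_cong2[of _ _ _ _ "add M"] M.M.finsum_cong') auto
    finally show ?thesis using G d by (simp add: flat_maps_def)
  qed
  have h_ideal: "h x = \<zero>\<^bsub>M\<^esub>" if "x \<in> generated_ideal L (holonomy_relations A)" for x
    by (rule Q.generated_ideal_in_kernel[OF M.bilinear_algebra_L h holonomy_relations_carrier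
          h_rel that])
  from Q.hom_factors[OF M.bilinear_algebra_L h h_ideal]
  obtain f where "f \<in> lie_hom Q.quot M" "\<forall>x\<in>carrier L. f (Q.proj x) = h x" by auto
  then show ?thesis
    unfolding holonomy_lie_def Let_def holonomy_incl_def
    by (intro bexI[of _ f]) (simp_all add: linearD(1)[OF incl_linear] hG)
qed

text \<open>Both quotient maps are onto, so generation descends from the free nonassociative algebra.\<close>

lemma holonomy_generated:
  assumes "subalgebra N (holonomy_lie A)" "\<And>u. u \<in> carrier A\<^sub>1 \<Longrightarrow> holonomy_incl u \<in> N"
  shows "N = carrier (holonomy_lie A)"
proof -
  interpret Q: algebra_ideal L "generated_ideal L (holonomy_relations A)"
    by (rule algebra_ideal_holonomy)
  have "subalgebra {x \<in> carrier L. Q.proj x \<in> N} L"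
    using assms(1) lie_hom_preimage_subalgebra[OF Q.bilinear_algebra_L Q.bilinear_algebra_quot Q.proj_hom]
    by (simp add: holonomy_lie_def Let_def)
  then have "{x \<in> carrier L. Q.proj x \<in> N} = carrier L"
    using assms(2) linearD(1)[OF incl_linear]
    by (intro cspace.free_lie_generated[OF cspace_A\<^sub>1]) (auto simp: holonomy_incl_def)
  then have "carrier (holonomy_lie A) \<subseteq> N" by (auto simp: holonomy_lie_def Let_def Q.carrier_quot)
  moreover have "N \<subseteq> carrier (holonomy_lie A)"
    using assms(1) subspaceD(1) by (auto simp: subalgebra_def)
  ultimately show ?thesis by simp
qed

lemma holonomy_incl_closed:
  "u \<in> carrier A\<^sub>1 \<Longrightarrow> holonomy_incl u \<in> carrier (holonomy_lie A)"
  using linearD(1)[OF incl_linear] algebra_ideal.carrier_quot[OF algebra_ideal_holonomy]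
  by (simp add: holonomy_incl_def holonomy_lie_def Let_def)

lemma lie_hom_image_in_subalgebra:
  assumes "bilinear_algebra M" "f \<in> lie_hom (holonomy_lie A) M" "subalgebra N M"
    and "\<And>u. u \<in> carrier A\<^sub>1 \<Longrightarrow> f (holonomy_incl u) \<in> N"
  shows "f ` carrier (holonomy_lie A) \<subseteq> N"
proof -
  have "{x \<in> carrier (holonomy_lie A). f x \<in> N} = carrier (holonomy_lie A)"
    using lie_hom_preimage_subalgebra[OF bilinear_algebra_holonomy assms(1-3)] assms(4)
      holonomy_incl_closed
    by (intro holonomy_generated) auto
  then show ?thesis by auto
qed

end

section \<open>Flat maps in coordinates\<close>

definition (in cspace) independent2 :: "'v \<Rightarrow> 'v \<Rightarrow> bool" where
  "independent2 x y \<longleftrightarrow> (\<forall>s t. s \<odot> x \<oplus> t \<odot> y = \<zero> \<longrightarrow> s = 0 \<and> t = 0)"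

lemma (in cspace) independent2_commute:
  assumes "x \<in> carrier V" "y \<in> carrier V"
  shows "independent2 x y \<longleftrightarrow> independent2 y x"
  using assms by (auto simp: independent2_def M.a_comm[of "_ \<odot> x" "_ \<odot> y"])

lemma (in cspace) line_subspace:
  assumes "x \<in> carrier V"
  shows "LinearCombinations.submodule class_ring (range (\<lambda>c. c \<odot> x)) V"
proof (rule subspaceI)
  show "\<zero> \<in> range (\<lambda>c. c \<odot> x)" using assms by (auto intro: range_eqI[of _ _ 0])
  fix y z assume "y \<in> range (\<lambda>c. c \<odot> x)" "z \<in> range (\<lambda>c. c \<odot> x)"
  then obtain a b where "y = a \<odot> x" "z = b \<odot> x" by auto
  then have "y \<oplus> z = (a + b) \<odot> x" using assms by (simp add: add_smult)
  then show "y \<oplus> z \<in> range (\<lambda>c. c \<odot> x)" by simp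
qed (use assms in \<open>auto simp: smult_smult\<close>)

lemma (in cspace) independent2_iff:
  assumes "x \<in> carrier V" "y \<in> carrier V"
  shows "independent2 x y \<longleftrightarrow> x \<noteq> \<zero> \<and> y \<notin> range (\<lambda>c. c \<odot> x)"
proof
  assume ind: "independent2 x y"
  note ind = ind[unfolded independent2_def, rule_format]
  have "x \<noteq> \<zero>" using ind[of 1 0] assms by auto
  moreover have "y \<noteq> c \<odot> x" for c
  proof
    assume "y = c \<odot> x"
    then have "(- c) \<odot> x \<oplus> 1 \<odot> y = \<zero>" using assms by (simp flip: add_smult)
    then show False using ind[of "- c" 1] by simp
  qed
  ultimately show "x \<noteq> \<zero> \<and> y \<notin> range (\<lambda>c. c \<odot> x)" by auto
next
  assume *: "x \<noteq> \<zero> \<and> y \<notin> range (\<lambda>c. c \<odot> x)"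
  have "s = 0 \<and> t = 0" if st: "s \<odot> x \<oplus> t \<odot> y = \<zero>" for s t
  proof -
    have "t = 0"
    proof (rule ccontr)
      assume "t \<noteq> 0"
      have "(- s / t) \<odot> x = (- s / t) \<odot> x \<oplus> (1 / t) \<odot> (s \<odot> x \<oplus> t \<odot> y)" using st assms by simp
      also have "\<dots> = ((- s / t) \<odot> x \<oplus> (s / t) \<odot> x) \<oplus> y"
        using assms \<open>t \<noteq> 0\<close> by (simp add: smult_add smult_smult M.a_assoc)
      also have "\<dots> = y" using assms by (simp flip: add_smult)
      finally show False using * by (metis rangeI)
    qed
    moreover have "s = 0"
    proof (rule ccontr)
      assume "s \<noteq> 0"
      have "s \<odot> x = \<zero>" using st assms \<open>t = 0\<close> by simp
      then have "(1 / s) \<odot> (s \<odot> x) = \<zero>" by simp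
      then show False using * assms \<open>s \<noteq> 0\<close> by (simp add: smult_smult)
    qed
    ultimately show ?thesis by simp
  qed
  then show "independent2 x y" by (simp add: independent2_def)
qed

text \<open>The functional separates \<open>x\<close> from the line through \<open>y\<close>.\<close>

lemma (in cspace) independent2_functional:
  assumes "x \<in> carrier V" "y \<in> carrier V" "independent2 x y"
  shows "\<exists>\<phi>\<in>carrier (dual_space V). \<phi> x = 1 \<and> \<phi> y = 0"
proof -
  have "x \<notin> range (\<lambda>c. c \<odot> y)"
    using assms independent2_commute[of x y] independent2_iff[of y x] by simp
  from separating_functional[OF line_subspace[OF assms(2)] assms(1) this]
  obtain \<phi> where \<phi>: "\<phi> \<in> carrier (dual_space V)" "\<And>w. w \<in> range (\<lambda>c. c \<odot> y) \<Longrightarrow> \<phi> w = 0" "\<phi> x = 1"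
    by metis
  have "y = 1 \<odot> y" using assms by simp
  then have "\<phi> y = 0" using \<phi>(2)[of y] by blast
  then show ?thesis using \<phi> by blast
qed

context one_finite_cdga
begin

text \<open>Reflexivity of \<open>A\<^sup>1\<close>: a coordinate of a linear map on \<open>A\<^sub>1\<close> is evaluation at an element of
  \<open>A\<^sup>1\<close>.\<close>

lemma functional_representative:
  assumes "G \<in> linear_maps A\<^sub>1 M" "c \<in> linear_maps M scalars"
  shows "\<exists>\<gamma>\<in>carrier (gr A 1). \<forall>u\<in>carrier A\<^sub>1. c (G u) = u \<gamma>"
proof -
  interpret V: cspace "gr A 1" by (rule cspace_gr)
  have "(\<lambda>u. c (G u)) \<in> linear_maps A\<^sub>1 scalars"
    using linearD[OF assms(1)] linearD[OF assms(2)] by (intro linearI) auto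
  from V.functional_on_dual_is_evaluation[OF fin_dim_one this] show ?thesis .
qed

lemma product_closed:
  "a \<in> carrier (gr A 1) \<Longrightarrow> b \<in> carrier (gr A 1) \<Longrightarrow> gmult A 1 1 a b \<in> carrier (gr A 2)"
  using linearD(1)[OF gmult_linear_right[of a 1 1]] by (simp add: one_add_one)

lemma diff_closed: "a \<in> carrier (gr A 1) \<Longrightarrow> gdiff A 1 a \<in> carrier (gr A 2)"
  using linearD(1)[OF gdiff_linear[of 1]] by (simp add: one_add_one)

text \<open>Elements of degree one anticommute, so \<open>(a, b) \<mapsto> \<phi>(a b)\<close> is alternating and the decomposition of
  alternating forms applies. Without such an expression there would be no relator for \<open>\<phi>\<close>.\<close>

lemma decomposition_exists:
  assumes \<phi>: "\<phi> \<in> carrier (dual_space (gr A 2))"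
  shows "\<exists>(n :: nat) u v. decomposes \<phi> n u v"
proof -
  interpret V: cspace "gr A 1" by (rule cspace_gr)
  note \<phi>' = dualD[OF \<phi>]
  let ?\<omega> = "\<lambda>a b. \<phi> (gmult A 1 1 a b)"
  have lin: "?\<omega> a \<in> linear_maps (gr A 1) scalars" if a: "a \<in> carrier (gr A 1)" for a
  proof (rule linearI)
    have g: "gmult A 1 1 a \<in> linear_maps (gr A 1) (gr A 2)"
      using gmult_linear_right[OF a, of 1] by (simp add: one_add_one)
    fix x y assume "x \<in> carrier (gr A 1)" "y \<in> carrier (gr A 1)"
    then show "?\<omega> a (x \<oplus>\<^bsub>gr A 1\<^esub> y) = ?\<omega> a x \<oplus>\<^bsub>scalars\<^esub> ?\<omega> a y"
      using linearD[OF g] \<phi>' by simp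
  next
    have g: "gmult A 1 1 a \<in> linear_maps (gr A 1) (gr A 2)"
      using gmult_linear_right[OF a, of 1] by (simp add: one_add_one)
    fix c x assume "x \<in> carrier (gr A 1)"
    then show "?\<omega> a (c \<odot>\<^bsub>gr A 1\<^esub> x) = c \<odot>\<^bsub>scalars\<^esub> ?\<omega> a x"
      using linearD[OF g] \<phi>' by simp
  qed simp
  have alt: "?\<omega> b a = - ?\<omega> a b" if "a \<in> carrier (gr A 1)" "b \<in> carrier (gr A 1)" for a b
  proof -
    have "gmult A 1 1 b a = (- 1) \<odot>\<^bsub>gr A 2\<^esub> gmult A 1 1 a b"
      using graded_commutative[OF that] by (simp add: one_add_one)
    then show ?thesis using \<phi>'(4)[OF product_closed[OF that], of "- 1"] by simp
  qed
  from V.alternating_form_decomposition[OF fin_dim_one lin alt]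
  obtain n :: nat and u v where
    "u \<in> {..<n} \<rightarrow> carrier A\<^sub>1" "v \<in> {..<n} \<rightarrow> carrier A\<^sub>1"
    "\<forall>a\<in>carrier (gr A 1). \<forall>b\<in>carrier (gr A 1).
       ?\<omega> a b = (\<Sum>k<n. u k a * v k b - u k b * v k a)" by auto
  then have "decomposes \<phi> n u v"
    using \<phi> by (auto simp: decomposes_def cup_dual_def wedge_def)
  then show ?thesis by blast
qed

text \<open>Write \<open>\<alpha>, \<beta>, \<gamma>\<close> for the elements that represent the coordinates \<open>p, q, c\<close> of \<open>G\<close>. The first part of
  the relator contributes \<open>\<phi>(d\<gamma>)\<close>. By the bracket formula the second contributes
  \<open>k \<Sum>\<^sub>i (u\<^sub>i \<and> v\<^sub>i)(\<alpha>, \<beta>)\<close>, and this is \<open>k \<phi>(\<alpha>\<beta>)\<close> by the choice of \<open>u\<close> and \<open>v\<close>.\<close>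

lemma relator_coordinate:
  assumes M: "bilinear_algebra M" and G: "G \<in> linear_maps A\<^sub>1 M"
    and c: "c \<in> linear_maps M scalars"
    and br: "\<And>x y. x \<in> carrier M \<Longrightarrow> y \<in> carrier M \<Longrightarrow>
      c (bracket M x y) = k * (p x * q y - p y * q x)"
    and mem: "\<alpha> \<in> carrier (gr A 1)" "\<beta> \<in> carrier (gr A 1)" "\<gamma> \<in> carrier (gr A 1)"
    and rep: "\<forall>u\<in>carrier A\<^sub>1. p (G u) = u \<alpha>" "\<forall>u\<in>carrier A\<^sub>1. q (G u) = u \<beta>"
      "\<forall>u\<in>carrier A\<^sub>1. c (G u) = u \<gamma>"
    and d: "decomposes \<phi> n u v"
  shows "c (relator M G \<phi> n u v) =
    \<phi> (gdiff A 1 \<gamma> \<oplus>\<^bsub>gr A 2\<^esub> k \<odot>\<^bsub>gr A 2\<^esub> gmult A 1 1 \<alpha> \<beta>)"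
proof -
  interpret M: bilinear_algebra M by fact
  interpret A2: cspace "gr A 2" by (rule cspace_gr)
  have \<phi>: "\<phi> \<in> carrier (dual_space (gr A 2))"
    and uv: "\<And>k. k < n \<Longrightarrow> u k \<in> carrier A\<^sub>1" "\<And>k. k < n \<Longrightarrow> v k \<in> carrier A\<^sub>1"
    and cup: "\<phi> (gmult A 1 1 \<alpha> \<beta>) = (\<Sum>k<n. u k \<alpha> * v k \<beta> - u k \<beta> * v k \<alpha>)"
    using d mem by (auto simp: decomposes_def cup_dual_def wedge_def)
  note G' = linearD[OF G] and c' = linearD[OF c]
  have br_in: "(\<lambda>k. bracket M (G (u k)) (G (v k))) \<in> {..<n} \<rightarrow> carrier M"
    using uv G'(1) by auto
  have "c (relator M G \<phi> n u v) =
      c (G (diff_dual A \<phi>)) + c (\<Oplus>\<^bsub>M\<^esub>k\<in>{..<n}. bracket M (G (u k)) (G (v k)))"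
    unfolding relator_def using c'(2) G'(1)[OF diff_dual_closed[OF \<phi>]] M.M.finsum_closed[OF br_in]
    by simp
  also have "c (G (diff_dual A \<phi>)) = \<phi> (gdiff A 1 \<gamma>)"
    using rep(3) diff_dual_closed[OF \<phi>] mem by (simp add: diff_dual_def)
  also have "c (\<Oplus>\<^bsub>M\<^esub>k\<in>{..<n}. bracket M (G (u k)) (G (v k))) =
      (\<Sum>i<n. c (bracket M (G (u i)) (G (v i))))"
    using functional_finsum[OF M.cspace_V c _ br_in] by simp
  also have "\<dots> = (\<Sum>i<n. k * (u i \<alpha> * v i \<beta> - u i \<beta> * v i \<alpha>))"
    using uv G'(1) rep by (intro sum.cong) (auto simp: br)
  also have "\<dots> = k * \<phi> (gmult A 1 1 \<alpha> \<beta>)"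
    by (simp add: cup sum_distrib_left)
  finally show ?thesis
    using dualD[OF \<phi>] product_closed[OF mem(1,2)] diff_closed[OF mem(3)] by simp
qed

text \<open>Every functional on \<open>A\<^sup>2\<close> occurs in some relator and therefore kills the left-hand side.\<close>

lemma maurer_cartan:
  assumes M: "bilinear_algebra M" and G: "G \<in> flat_maps M"
    and c: "c \<in> linear_maps M scalars"
    and br: "\<And>x y. x \<in> carrier M \<Longrightarrow> y \<in> carrier M \<Longrightarrow>
      c (bracket M x y) = k * (p x * q y - p y * q x)"
    and mem: "\<alpha> \<in> carrier (gr A 1)" "\<beta> \<in> carrier (gr A 1)" "\<gamma> \<in> carrier (gr A 1)"
    and rep: "\<forall>u\<in>carrier A\<^sub>1. p (G u) = u \<alpha>" "\<forall>u\<in>carrier A\<^sub>1. q (G u) = u \<beta>"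
      "\<forall>u\<in>carrier A\<^sub>1. c (G u) = u \<gamma>"
  shows "gdiff A 1 \<gamma> \<oplus>\<^bsub>gr A 2\<^esub> k \<odot>\<^bsub>gr A 2\<^esub> gmult A 1 1 \<alpha> \<beta> = \<zero>\<^bsub>gr A 2\<^esub>"
proof -
  interpret M: bilinear_algebra M by fact
  interpret A2: cspace "gr A 2" by (rule cspace_gr)
  have G_lin: "G \<in> linear_maps A\<^sub>1 M" using G by (simp add: flat_maps_def)
  show ?thesis
  proof (rule A2.zero_if_functionals_vanish)
    fix \<phi> assume "\<phi> \<in> carrier (dual_space (gr A 2))"
    then obtain n :: nat and u v where d: "decomposes \<phi> n u v" using decomposition_exists by blast
    have "relator M G \<phi> n u v = \<zero>\<^bsub>M\<^esub>" using G d by (simp add: flat_maps_def)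
    then show "\<phi> (gdiff A 1 \<gamma> \<oplus>\<^bsub>gr A 2\<^esub> k \<odot>\<^bsub>gr A 2\<^esub> gmult A 1 1 \<alpha> \<beta>) = 0"
      using relator_coordinate[OF M G_lin c br mem rep d]
        linear_zero[OF M.cspace_V cspace_scalars c] by simp
  qed (use product_closed diff_closed mem in auto)
qed

end

section \<open>Target algebras with two distinguished coordinates\<close>

text \<open>A common setting for \<open>sol\<^sub>2\<close> and \<open>heis\<^sub>3\<close>. The coordinates \<open>(p, q)\<close> map the algebra onto
  the plane, and by the bracket formulas the preimage of every line through the origin is a proper
  subalgebra. Conversely, elements with independent coordinates generate.\<close>

locale planar_lie_algebra = lie_algebra M for M :: "'b bracket_algebra" +
  fixes p q :: "'b \<Rightarrow> complex" and \<mu> :: complex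
  assumes p_linear: "p \<in> linear_maps M scalars" and q_linear: "q \<in> linear_maps M scalars"
    and p_bracket: "x \<in> carrier M \<Longrightarrow> y \<in> carrier M \<Longrightarrow> p (bracket M x y) = 0"
    and q_bracket: "x \<in> carrier M \<Longrightarrow> y \<in> carrier M \<Longrightarrow>
      q (bracket M x y) = \<mu> * (p x * q y - p y * q x)"
    and coordinate_vectors: "\<exists>x\<in>carrier M. p x = 1 \<and> q x = 0" "\<exists>y\<in>carrier M. p y = 0 \<and> q y = 1"
    and generate: "subalgebra N M \<Longrightarrow> x \<in> N \<Longrightarrow> y \<in> N \<Longrightarrow> p x = 1 \<Longrightarrow> q x = 0 \<Longrightarrow>
      p y = 0 \<Longrightarrow> q y = 1 \<Longrightarrow> N = carrier M"
begin

text \<open>On a line through the origin any two coordinate vectors are proportional, so the determinant in the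
  bracket formula vanishes.\<close>

lemma line_preimage_subalgebra:
  assumes "s \<noteq> 0 \<or> t \<noteq> 0"
  shows "subalgebra {x \<in> carrier M. s * p x + t * q x = 0} M"
  unfolding subalgebra_def
proof (intro conjI ballI subspaceI)
  fix x y assume "x \<in> {x \<in> carrier M. s * p x + t * q x = 0}" "y \<in> {x \<in> carrier M. s * p x + t * q x = 0}"
  then have x: "x \<in> carrier M" "s * p x + t * q x = 0" and y: "y \<in> carrier M" "s * p y + t * q y = 0"
    by auto
  have "t * (p x * q y - p y * q x) = p x * (s * p y + t * q y) - p y * (s * p x + t * q x)"
    "s * (p x * q y - p y * q x) = q y * (s * p x + t * q x) - q x * (s * p y + t * q y)"
    by (simp_all add: algebra_simps)
  then have "p x * q y - p y * q x = 0" using x y assms by auto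
  then show "bracket M x y \<in> {x \<in> carrier M. s * p x + t * q x = 0}"
    using x y p_bracket q_bracket by simp
  have "s * (p x + p y) + t * (q x + q y) = (s * p x + t * q x) + (s * p y + t * q y)"
    by (simp add: algebra_simps)
  then show "x \<oplus>\<^bsub>M\<^esub> y \<in> {x \<in> carrier M. s * p x + t * q x = 0}"
    using x y linearD(2)[OF p_linear] linearD(2)[OF q_linear] by simp
next
  fix c x assume x: "x \<in> {x \<in> carrier M. s * p x + t * q x = 0}"
  have "s * (c * p x) + t * (c * q x) = c * (s * p x + t * q x)" by (simp add: algebra_simps)
  then show "c \<odot>\<^bsub>M\<^esub> x \<in> {x \<in> carrier M. s * p x + t * q x = 0}"
    using x linearD(3)[OF p_linear] linearD(3)[OF q_linear] by simp
next
  show "\<zero>\<^bsub>M\<^esub> \<in> {x \<in> carrier M. s * p x + t * q x = 0}"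
    using linear_zero[OF cspace_V cspace_scalars p_linear]
      linear_zero[OF cspace_V cspace_scalars q_linear] by simp
qed auto

end

text \<open>A relation \<open>s \<alpha> + t \<beta> = 0\<close> puts the images of all generators over the line \<open>s p + t q = 0\<close>. If there
  is no relation, functionals dual to \<open>\<alpha>, \<beta>\<close> supply generators whose images have coordinates \<open>(1, 0)\<close>
  and \<open>(0, 1)\<close>.\<close>

lemma (in one_finite_cdga) surjective_iff_independent:
  assumes "planar_lie_algebra M p q \<mu>" and f: "f \<in> lie_hom (holonomy_lie A) M"
    and mem: "\<alpha> \<in> carrier (gr A 1)" "\<beta> \<in> carrier (gr A 1)"
    and rep: "\<forall>u\<in>carrier A\<^sub>1. p (f (holonomy_incl u)) = u \<alpha>"
      "\<forall>u\<in>carrier A\<^sub>1. q (f (holonomy_incl u)) = u \<beta>"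
  shows "f ` carrier (holonomy_lie A) = carrier M \<longleftrightarrow> cspace.independent2 (gr A 1) \<alpha> \<beta>"
proof -
  interpret M: planar_lie_algebra M p q \<mu> by fact
  interpret V: cspace "gr A 1" by (rule cspace_gr)
  show ?thesis
  proof
    assume surj: "f ` carrier (holonomy_lie A) = carrier M"
    show "V.independent2 \<alpha> \<beta>" unfolding V.independent2_def
    proof (intro allI impI, rule ccontr)
      fix s t assume st: "s \<odot>\<^bsub>gr A 1\<^esub> \<alpha> \<oplus>\<^bsub>gr A 1\<^esub> t \<odot>\<^bsub>gr A 1\<^esub> \<beta> = \<zero>\<^bsub>gr A 1\<^esub>"
        and nz: "\<not> (s = 0 \<and> t = 0)"
      let ?N = "{x \<in> carrier M. s * p x + t * q x = 0}"
      have incl: "f (holonomy_incl u) \<in> ?N" if u: "u \<in> carrier A\<^sub>1" for u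
      proof -
        have "s * u \<alpha> + t * u \<beta> = u (s \<odot>\<^bsub>gr A 1\<^esub> \<alpha> \<oplus>\<^bsub>gr A 1\<^esub> t \<odot>\<^bsub>gr A 1\<^esub> \<beta>)"
          using mem dualD[OF u] by simp
        also have "\<dots> = 0"
          using st linear_zero[OF V.cspace_V cspace_scalars dualD(1)[OF u]] by simp
        finally show ?thesis
          using u rep lie_homD(2)[OF f holonomy_incl_closed[OF u]] by simp
      qed
      have "subalgebra ?N M" using nz by (intro M.line_preimage_subalgebra) auto
      from lie_hom_image_in_subalgebra[OF M.bilinear_algebra_L f this incl]
      have N: "carrier M \<subseteq> ?N" using surj by simp
      obtain x where x: "x \<in> carrier M \<and> p x = 1 \<and> q x = 0"
        using M.coordinate_vectors(1) by (elim bexE) (rule that, rule conjI)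
      obtain y where y: "y \<in> carrier M \<and> p y = 0 \<and> q y = 1"
        using M.coordinate_vectors(2) by (elim bexE) (rule that, rule conjI)
      show False using subsetD[OF N, of x] subsetD[OF N, of y] x y nz by simp
    qed
  next
    assume ind: "V.independent2 \<alpha> \<beta>"
    obtain u where u: "u \<in> carrier A\<^sub>1" "u \<alpha> = 1" "u \<beta> = 0"
      using V.independent2_functional[OF mem ind] by blast
    obtain v where v: "v \<in> carrier A\<^sub>1" "v \<beta> = 1" "v \<alpha> = 0"
      using V.independent2_functional[OF mem(2,1)] ind V.independent2_commute[OF mem] by blast
    show "f ` carrier (holonomy_lie A) = carrier M"
    proof (rule M.generate)
      show "subalgebra (f ` carrier (holonomy_lie A)) M"
        by (rule lie_hom_image_subalgebra[OF bilinear_algebra_holonomy M.bilinear_algebra_L f])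
      show "f (holonomy_incl u) \<in> f ` carrier (holonomy_lie A)"
        "f (holonomy_incl v) \<in> f ` carrier (holonomy_lie A)"
        using holonomy_incl_closed u v by auto
    qed (use rep u v in auto)
  qed
qed

section \<open>The two target Lie algebras\<close>

text \<open>The diagonal entry is halved so that the bracket of coordinate vectors is their determinant. With
  the usual basis a factor 2 would appear, and \<open>\<alpha>\<close> would represent half of a resonant class.\<close>

definition sol2_elem :: "complex \<Rightarrow> complex \<Rightarrow> complex mat" where
  "sol2_elem x y = mat 2 2 (\<lambda>(i, j).
     if i = 0 \<and> j = 0 then x / 2 else if i = 0 \<and> j = 1 then y else if i = 1 \<and> j = 1 then - x / 2 else 0)"

lemma mat2_eqI:
  assumes "M \<in> carrier_mat 2 2" "N \<in> carrier_mat 2 2"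
    and "M $$ (0, 0) = N $$ (0, 0)" "M $$ (0, 1) = N $$ (0, 1)"
      "M $$ (1, 0) = N $$ (1, 0)" "M $$ (1, 1) = N $$ (1, 1)"
  shows "M = N"
  using assms by (intro eq_matI) (auto simp: less_2_cases_iff One_nat_def)

lemma carrier_sol2: "carrier sol2 = {sol2_elem x y | x y. True}"
proof (intro equalityI subsetI)
  fix M assume "M \<in> carrier sol2"
  then have M: "M \<in> carrier_mat 2 2" "M $$ (0, 0) + M $$ (1, 1) = 0" "M $$ (1, 0) = 0"
    by (auto simp: sol2_def numeral_2_eq_2 upper_triangular_def One_nat_def)
  then have "M $$ (1, 1) = - M $$ (0, 0)" by (simp add: eq_neg_iff_add_eq_0 add.commute)
  with M have "M = sol2_elem (2 * M $$ (0, 0)) (M $$ (0, 1))"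
    by (intro mat2_eqI) (auto simp: sol2_elem_def)
  then show "M \<in> {sol2_elem x y | x y. True}"
    by blast
next
  fix M assume "M \<in> {sol2_elem x y | x y. True}"
  then show "M \<in> carrier sol2"
    by (auto simp: sol2_def sol2_elem_def numeral_2_eq_2 upper_triangular_def One_nat_def)
qed

lemma sol2_elem_ops:
  "\<zero>\<^bsub>sol2\<^esub> = sol2_elem 0 0"
  "sol2_elem x y \<oplus>\<^bsub>sol2\<^esub> sol2_elem x' y' = sol2_elem (x + x') (y + y')"
  "c \<odot>\<^bsub>sol2\<^esub> sol2_elem x y = sol2_elem (c * x) (c * y)"
  "bracket sol2 (sol2_elem x y) (sol2_elem x' y') = sol2_elem 0 (x * y' - x' * y)"
proof -
  show "\<zero>\<^bsub>sol2\<^esub> = sol2_elem 0 0"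
    by (rule mat2_eqI) (auto simp: sol2_def sol2_elem_def)
  show "sol2_elem x y \<oplus>\<^bsub>sol2\<^esub> sol2_elem x' y' = sol2_elem (x + x') (y + y')"
    by (rule mat2_eqI) (auto simp: sol2_def sol2_elem_def field_simps)
  show "c \<odot>\<^bsub>sol2\<^esub> sol2_elem x y = sol2_elem (c * x) (c * y)"
    by (rule mat2_eqI) (auto simp: sol2_def sol2_elem_def)
  show "bracket sol2 (sol2_elem x y) (sol2_elem x' y') = sol2_elem 0 (x * y' - x' * y)"
    by (rule mat2_eqI)
      (auto simp: sol2_def sol2_elem_def scalar_prod_def numeral_2_eq_2 One_nat_def field_simps)
qed

definition sol2_p :: "complex mat \<Rightarrow> complex" where "sol2_p M = 2 * M $$ (0, 0)"
definition sol2_q :: "complex mat \<Rightarrow> complex" where "sol2_q M = M $$ (0, 1)"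

lemma sol2_coordinates [simp]: "sol2_p (sol2_elem x y) = x" "sol2_q (sol2_elem x y) = y"
  by (simp_all add: sol2_p_def sol2_q_def sol2_elem_def)

lemma planar_sol2: "planar_lie_algebra sol2 sol2_p sol2_q 1"
proof -
  have "cspace sol2"
  proof (rule cspaceI)
    fix M N assume "M \<in> carrier sol2" "N \<in> carrier sol2"
    then show "M \<oplus>\<^bsub>sol2\<^esub> N \<in> carrier sol2"
      unfolding carrier_sol2 using sol2_elem_ops(2) by blast
  next
    fix c M assume "M \<in> carrier sol2"
    then show "c \<odot>\<^bsub>sol2\<^esub> M \<in> carrier sol2"
      unfolding carrier_sol2 using sol2_elem_ops(3) by blast
  qed (auto simp: carrier_sol2 sol2_elem_ops algebra_simps)
  then have "lie_algebra sol2"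
  proof (intro lie_algebra.intro bilinear_algebra.intro bilinear_algebra_axioms.intro
      lie_algebra_axioms.intro)
    fix M N assume "M \<in> carrier sol2" "N \<in> carrier sol2"
    then show "bracket sol2 M N \<in> carrier sol2"
      unfolding carrier_sol2 using sol2_elem_ops(4) by blast
  qed (auto simp: carrier_sol2 sol2_elem_ops algebra_simps)
  moreover have "N = carrier sol2"
    if N: "subalgebra N sol2" "x \<in> N" "y \<in> N"
      and xy: "sol2_p x = 1" "sol2_q x = 0" "sol2_p y = 0" "sol2_q y = 1" for N x y
  proof
    have sub: "LinearCombinations.submodule class_ring N sol2" using N by (simp add: subalgebra_def)
    show "N \<subseteq> carrier sol2" by (rule subspaceD(1)[OF sub])
    have "x \<in> carrier sol2" "y \<in> carrier sol2" using N subspaceD(1)[OF sub] by auto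
    then have x: "x = sol2_elem 1 0" and y: "y = sol2_elem 0 1" using xy by (auto simp: carrier_sol2)
    show "carrier sol2 \<subseteq> N"
    proof
      fix z assume "z \<in> carrier sol2"
      then obtain a b where "z = sol2_elem a b" by (auto simp: carrier_sol2)
      then have "z = (a \<odot>\<^bsub>sol2\<^esub> x) \<oplus>\<^bsub>sol2\<^esub> (b \<odot>\<^bsub>sol2\<^esub> y)" by (simp add: x y sol2_elem_ops)
      then show "z \<in> N" using subspaceD(3,4)[OF sub] N by simp
    qed
  qed
  moreover have "\<exists>x\<in>carrier sol2. sol2_p x = 1 \<and> sol2_q x = 0"
    by (rule bexI[of _ "sol2_elem 1 0"]) (auto simp: carrier_sol2)
  moreover have "\<exists>y\<in>carrier sol2. sol2_p y = 0 \<and> sol2_q y = 1"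
    by (rule bexI[of _ "sol2_elem 0 1"]) (auto simp: carrier_sol2)
  ultimately show ?thesis
    by (intro planar_lie_algebra.intro planar_lie_algebra_axioms.intro linearI)
      (auto simp: carrier_sol2 sol2_elem_ops)
qed

definition heis3_p :: "complex \<times> complex \<times> complex \<Rightarrow> complex" where "heis3_p v = fst v"
definition heis3_q :: "complex \<times> complex \<times> complex \<Rightarrow> complex" where "heis3_q v = fst (snd v)"
definition heis3_r :: "complex \<times> complex \<times> complex \<Rightarrow> complex" where "heis3_r v = snd (snd v)"

lemma heis3_coordinates [simp]: "heis3_p (a, b, c) = a" "heis3_q (a, b, c) = b" "heis3_r (a, b, c) = c"
  by (simp_all add: heis3_p_def heis3_q_def heis3_r_def)

lemma heis3_ops:
  "carrier heis3 = UNIV"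
  "\<zero>\<^bsub>heis3\<^esub> = (0, 0, 0)"
  "(a, b, c) \<oplus>\<^bsub>heis3\<^esub> (a', b', c') = (a + a', b + b', c + c')"
  "k \<odot>\<^bsub>heis3\<^esub> (a, b, c) = (k * a, k * b, k * c)"
  "bracket heis3 (a, b, c) (a', b', c') = (0, 0, a * b' - a' * b)"
  by (simp_all add: heis3_def)

lemma heis3_r_linear: "heis3_r \<in> linear_maps heis3 scalars"
  by (rule linearI) (auto simp: heis3_ops)

lemma planar_heis3: "planar_lie_algebra heis3 heis3_p heis3_q 0"
proof -
  have "cspace heis3"
    by (rule cspaceI) (auto simp: heis3_ops algebra_simps)
  then have "lie_algebra heis3"
    by (intro lie_algebra.intro bilinear_algebra.intro bilinear_algebra_axioms.intro
          lie_algebra_axioms.intro) (auto simp: heis3_ops algebra_simps)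
  moreover have "N = carrier heis3"
    if N: "subalgebra N heis3" "x \<in> N" "y \<in> N"
      and xy: "heis3_p x = 1" "heis3_q x = 0" "heis3_p y = 0" "heis3_q y = 1" for N x y
  proof
    have sub: "LinearCombinations.submodule class_ring N heis3" using N by (simp add: subalgebra_def)
    show "N \<subseteq> carrier heis3" by (rule subspaceD(1)[OF sub])
    obtain k l where x: "x = (1, 0, k)" and y: "y = (0, 1, l)"
      using xy by (cases x; cases y) auto
    have z: "bracket heis3 x y \<in> N" using N by (simp add: subalgebra_def)
    show "carrier heis3 \<subseteq> N"
    proof
      fix w :: "complex \<times> complex \<times> complex"
      obtain a b c where w: "w = (a, b, c)" by (cases w) auto
      \<comment> \<open>The central coordinate is adjusted by the bracket of the two generators.\<close>
      have "w = (a \<odot>\<^bsub>heis3\<^esub> x \<oplus>\<^bsub>heis3\<^esub> b \<odot>\<^bsub>heis3\<^esub> y)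
          \<oplus>\<^bsub>heis3\<^esub> (c - a * k - b * l) \<odot>\<^bsub>heis3\<^esub> bracket heis3 x y"
        by (simp add: w x y heis3_ops)
      then show "w \<in> N" using subspaceD(3,4)[OF sub] N z by simp
    qed
  qed
  ultimately show ?thesis
    by (intro planar_lie_algebra.intro planar_lie_algebra_axioms.intro linearI)
      (auto simp: heis3_ops)
qed

context one_finite_cdga
begin

text \<open>The two coordinates of a flat map to \<open>sol\<^sub>2\<close> are represented by \<open>\<alpha>\<close> and \<open>\<beta>\<close>. They satisfy the
  Maurer-Cartan equations with the constants 0 and 1 of the bracket formula, and conversely any
  solution defines a flat map.\<close>

lemma sol2_surjection_iff:
  "(\<exists>f\<in>lie_hom (holonomy_lie A) sol2. f ` carrier (holonomy_lie A) = carrier sol2) \<longleftrightarrow>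
   (\<exists>\<alpha>\<in>carrier (gr A 1). \<exists>\<beta>\<in>carrier (gr A 1). cspace.independent2 (gr A 1) \<alpha> \<beta> \<and>
      gdiff A 1 \<alpha> = \<zero>\<^bsub>gr A 2\<^esub> \<and>
      gdiff A 1 \<beta> \<oplus>\<^bsub>gr A 2\<^esub> gmult A 1 1 \<alpha> \<beta> = \<zero>\<^bsub>gr A 2\<^esub>)"
    (is "?L \<longleftrightarrow> ?R")
proof -
  interpret M: planar_lie_algebra sol2 sol2_p sol2_q 1 by (rule planar_sol2)
  interpret V: cspace "gr A 1" by (rule cspace_gr)
  interpret A2: cspace "gr A 2" by (rule cspace_gr)
  note br = M.p_bracket M.q_bracket
  show ?thesis
  proof
    assume ?L
    then obtain f where f: "f \<in> lie_hom (holonomy_lie A) sol2"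
      and surj: "f ` carrier (holonomy_lie A) = carrier sol2" by auto
    let ?G = "\<lambda>u. f (holonomy_incl u)"
    have flat: "?G \<in> flat_maps sol2" by (rule lie_hom_flat[OF M.bilinear_algebra_L f])
    then have lin: "?G \<in> linear_maps A\<^sub>1 sol2" by (simp add: flat_maps_def)
    obtain \<alpha> where \<alpha>: "\<alpha> \<in> carrier (gr A 1)" "\<forall>u\<in>carrier A\<^sub>1. sol2_p (?G u) = u \<alpha>"
      using functional_representative[OF lin M.p_linear] by auto
    obtain \<beta> where \<beta>: "\<beta> \<in> carrier (gr A 1)" "\<forall>u\<in>carrier A\<^sub>1. sol2_q (?G u) = u \<beta>"
      using functional_representative[OF lin M.q_linear] by auto
    have "V.independent2 \<alpha> \<beta>"
      using surjective_iff_independent[OF planar_sol2 f \<alpha>(1) \<beta>(1) \<alpha>(2) \<beta>(2)] surj by simp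
    moreover have "gdiff A 1 \<alpha> \<oplus>\<^bsub>gr A 2\<^esub> 0 \<odot>\<^bsub>gr A 2\<^esub> gmult A 1 1 \<alpha> \<beta> = \<zero>\<^bsub>gr A 2\<^esub>"
      by (rule maurer_cartan[OF M.bilinear_algebra_L flat M.p_linear _ \<alpha>(1) \<beta>(1) \<alpha>(1) \<alpha>(2) \<beta>(2) \<alpha>(2)])
        (simp add: br)
    moreover have "gdiff A 1 \<beta> \<oplus>\<^bsub>gr A 2\<^esub> 1 \<odot>\<^bsub>gr A 2\<^esub> gmult A 1 1 \<alpha> \<beta> = \<zero>\<^bsub>gr A 2\<^esub>"
      by (rule maurer_cartan[OF M.bilinear_algebra_L flat M.q_linear M.q_bracket \<alpha>(1) \<beta>(1) \<beta>(1) \<alpha>(2) \<beta>(2) \<beta>(2)])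
    ultimately show ?R
      using \<alpha>(1) \<beta>(1) diff_closed product_closed by (intro bexI[of _ \<alpha>] bexI[of _ \<beta>]) auto
  next
    assume ?R
    then obtain \<alpha> \<beta> where mem: "\<alpha> \<in> carrier (gr A 1)" "\<beta> \<in> carrier (gr A 1)"
      and ind: "V.independent2 \<alpha> \<beta>"
      and mc: "gdiff A 1 \<alpha> = \<zero>\<^bsub>gr A 2\<^esub>" "gdiff A 1 \<beta> \<oplus>\<^bsub>gr A 2\<^esub> gmult A 1 1 \<alpha> \<beta> = \<zero>\<^bsub>gr A 2\<^esub>"
      by auto
    let ?G = "\<lambda>u. sol2_elem (u \<alpha>) (u \<beta>)"
    have lin: "?G \<in> linear_maps A\<^sub>1 sol2"
      using mem by (intro linearI) (auto simp: carrier_sol2 sol2_elem_ops dual_ops)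
    have rep: "\<forall>u\<in>carrier A\<^sub>1. sol2_p (?G u) = u \<alpha>" "\<forall>u\<in>carrier A\<^sub>1. sol2_q (?G u) = u \<beta>" by auto
    have "relator sol2 ?G \<phi> n u v = \<zero>\<^bsub>sol2\<^esub>" if d: "decomposes \<phi> n u v" for \<phi> n u v
    proof -
      have \<phi>: "\<phi> \<zero>\<^bsub>gr A 2\<^esub> = 0"
        using d linear_zero[OF A2.cspace_V cspace_scalars dualD(1)] by (auto simp: decomposes_def)
      have "sol2_p (relator sol2 ?G \<phi> n u v) =
          \<phi> (gdiff A 1 \<alpha> \<oplus>\<^bsub>gr A 2\<^esub> 0 \<odot>\<^bsub>gr A 2\<^esub> gmult A 1 1 \<alpha> \<beta>)"
        by (rule relator_coordinate[OF M.bilinear_algebra_L lin M.p_linear _ mem mem(1) rep rep(1) d])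
          (simp add: br)
      moreover have "sol2_q (relator sol2 ?G \<phi> n u v) =
          \<phi> (gdiff A 1 \<beta> \<oplus>\<^bsub>gr A 2\<^esub> 1 \<odot>\<^bsub>gr A 2\<^esub> gmult A 1 1 \<alpha> \<beta>)"
        by (rule relator_coordinate[OF M.bilinear_algebra_L lin M.q_linear M.q_bracket mem mem(2) rep rep(2) d])
      moreover have "relator sol2 ?G \<phi> n u v \<in> carrier sol2"
        by (rule relator_closed[OF M.bilinear_algebra_L lin d])
      ultimately show ?thesis
        using mc mem \<phi> product_closed by (auto simp: carrier_sol2 sol2_elem_ops)
    qed
    then have "?G \<in> flat_maps sol2" using lin by (simp add: flat_maps_def)
    from flat_map_extends[OF M.lie_algebra_axioms this]
    obtain f where f: "f \<in> lie_hom (holonomy_lie A) sol2"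
      and fG: "\<forall>u\<in>carrier A\<^sub>1. f (holonomy_incl u) = ?G u" by auto
    have "f ` carrier (holonomy_lie A) = carrier sol2"
      using surjective_iff_independent[OF planar_sol2 f mem] fG ind by simp
    then show ?L using f by auto
  qed
qed

text \<open>The third coordinate, along the centre, contributes an element \<open>\<gamma>\<close> that is subject only to
  \<open>d\<gamma> + \<alpha>\<beta> = 0\<close>. Brackets reach the centre, so surjectivity depends on \<open>\<alpha>\<close> and
  \<open>\<beta>\<close> alone.\<close>

lemma heis3_surjection_iff:
  "(\<exists>f\<in>lie_hom (holonomy_lie A) heis3. f ` carrier (holonomy_lie A) = carrier heis3) \<longleftrightarrow>
   (\<exists>\<alpha>\<in>carrier (gr A 1). \<exists>\<beta>\<in>carrier (gr A 1). \<exists>\<gamma>\<in>carrier (gr A 1).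
      cspace.independent2 (gr A 1) \<alpha> \<beta> \<and>
      gdiff A 1 \<alpha> = \<zero>\<^bsub>gr A 2\<^esub> \<and> gdiff A 1 \<beta> = \<zero>\<^bsub>gr A 2\<^esub> \<and>
      gdiff A 1 \<gamma> \<oplus>\<^bsub>gr A 2\<^esub> gmult A 1 1 \<alpha> \<beta> = \<zero>\<^bsub>gr A 2\<^esub>)"
    (is "?L \<longleftrightarrow> ?R")
proof -
  interpret M: planar_lie_algebra heis3 heis3_p heis3_q 0 by (rule planar_heis3)
  interpret V: cspace "gr A 1" by (rule cspace_gr)
  interpret A2: cspace "gr A 2" by (rule cspace_gr)
  note br = M.p_bracket M.q_bracket
  have r_bracket: "heis3_r (bracket heis3 x y) = 1 * (heis3_p x * heis3_q y - heis3_p y * heis3_q x)" for x y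
    by (cases x; cases y) (auto simp: heis3_ops)
  show ?thesis
  proof
    assume ?L
    then obtain f where f: "f \<in> lie_hom (holonomy_lie A) heis3"
      and surj: "f ` carrier (holonomy_lie A) = carrier heis3" by auto
    let ?G = "\<lambda>u. f (holonomy_incl u)"
    have flat: "?G \<in> flat_maps heis3" by (rule lie_hom_flat[OF M.bilinear_algebra_L f])
    then have lin: "?G \<in> linear_maps A\<^sub>1 heis3" by (simp add: flat_maps_def)
    obtain \<alpha> where \<alpha>: "\<alpha> \<in> carrier (gr A 1)" "\<forall>u\<in>carrier A\<^sub>1. heis3_p (?G u) = u \<alpha>"
      using functional_representative[OF lin M.p_linear] by auto
    obtain \<beta> where \<beta>: "\<beta> \<in> carrier (gr A 1)" "\<forall>u\<in>carrier A\<^sub>1. heis3_q (?G u) = u \<beta>"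
      using functional_representative[OF lin M.q_linear] by auto
    obtain \<gamma> where \<gamma>: "\<gamma> \<in> carrier (gr A 1)" "\<forall>u\<in>carrier A\<^sub>1. heis3_r (?G u) = u \<gamma>"
      using functional_representative[OF lin heis3_r_linear] by auto
    note rep = \<alpha>(2) \<beta>(2)
    have "V.independent2 \<alpha> \<beta>"
      using surjective_iff_independent[OF planar_heis3 f \<alpha>(1) \<beta>(1) \<alpha>(2) \<beta>(2)] surj by simp
    moreover have "gdiff A 1 \<alpha> \<oplus>\<^bsub>gr A 2\<^esub> 0 \<odot>\<^bsub>gr A 2\<^esub> gmult A 1 1 \<alpha> \<beta> = \<zero>\<^bsub>gr A 2\<^esub>"
      by (rule maurer_cartan[OF M.bilinear_algebra_L flat M.p_linear _ \<alpha>(1) \<beta>(1) \<alpha>(1) rep \<alpha>(2)])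
        (simp add: br)
    moreover have "gdiff A 1 \<beta> \<oplus>\<^bsub>gr A 2\<^esub> 0 \<odot>\<^bsub>gr A 2\<^esub> gmult A 1 1 \<alpha> \<beta> = \<zero>\<^bsub>gr A 2\<^esub>"
      by (rule maurer_cartan[OF M.bilinear_algebra_L flat M.q_linear M.q_bracket \<alpha>(1) \<beta>(1) \<beta>(1) rep \<beta>(2)])
    moreover have "gdiff A 1 \<gamma> \<oplus>\<^bsub>gr A 2\<^esub> 1 \<odot>\<^bsub>gr A 2\<^esub> gmult A 1 1 \<alpha> \<beta> = \<zero>\<^bsub>gr A 2\<^esub>"
      by (rule maurer_cartan[OF M.bilinear_algebra_L flat heis3_r_linear r_bracket \<alpha>(1) \<beta>(1) \<gamma>(1) rep \<gamma>(2)])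
    ultimately show ?R
      using \<alpha>(1) \<beta>(1) \<gamma>(1) diff_closed product_closed
      by (intro bexI[of _ \<alpha>] bexI[of _ \<beta>] bexI[of _ \<gamma>]) auto
  next
    assume ?R
    then obtain \<alpha> \<beta> \<gamma> where mem: "\<alpha> \<in> carrier (gr A 1)" "\<beta> \<in> carrier (gr A 1)"
      and \<gamma>: "\<gamma> \<in> carrier (gr A 1)"
      and ind: "V.independent2 \<alpha> \<beta>"
      and mc: "gdiff A 1 \<alpha> = \<zero>\<^bsub>gr A 2\<^esub>" "gdiff A 1 \<beta> = \<zero>\<^bsub>gr A 2\<^esub>"
        "gdiff A 1 \<gamma> \<oplus>\<^bsub>gr A 2\<^esub> gmult A 1 1 \<alpha> \<beta> = \<zero>\<^bsub>gr A 2\<^esub>"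
      by auto
    let ?G = "\<lambda>u. (u \<alpha>, u \<beta>, u \<gamma>)"
    have lin: "?G \<in> linear_maps A\<^sub>1 heis3"
      using mem \<gamma> by (intro linearI) (auto simp: heis3_ops dual_ops)
    have rep: "\<forall>u\<in>carrier A\<^sub>1. heis3_p (?G u) = u \<alpha>" "\<forall>u\<in>carrier A\<^sub>1. heis3_q (?G u) = u \<beta>"
      "\<forall>u\<in>carrier A\<^sub>1. heis3_r (?G u) = u \<gamma>" by auto
    have "relator heis3 ?G \<phi> n u v = \<zero>\<^bsub>heis3\<^esub>" if d: "decomposes \<phi> n u v" for \<phi> n u v
    proof -
      have \<phi>: "\<phi> \<zero>\<^bsub>gr A 2\<^esub> = 0"
        using d linear_zero[OF A2.cspace_V cspace_scalars dualD(1)] by (auto simp: decomposes_def)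
      have "heis3_p (relator heis3 ?G \<phi> n u v) =
          \<phi> (gdiff A 1 \<alpha> \<oplus>\<^bsub>gr A 2\<^esub> 0 \<odot>\<^bsub>gr A 2\<^esub> gmult A 1 1 \<alpha> \<beta>)"
        by (rule relator_coordinate[OF M.bilinear_algebra_L lin M.p_linear _ mem mem(1) rep(1,2) rep(1) d])
          (simp add: br)
      moreover have "heis3_q (relator heis3 ?G \<phi> n u v) =
          \<phi> (gdiff A 1 \<beta> \<oplus>\<^bsub>gr A 2\<^esub> 0 \<odot>\<^bsub>gr A 2\<^esub> gmult A 1 1 \<alpha> \<beta>)"
        by (rule relator_coordinate[OF M.bilinear_algebra_L lin M.q_linear M.q_bracket mem mem(2) rep(1,2) rep(2) d])
      moreover have "heis3_r (relator heis3 ?G \<phi> n u v) =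
          \<phi> (gdiff A 1 \<gamma> \<oplus>\<^bsub>gr A 2\<^esub> 1 \<odot>\<^bsub>gr A 2\<^esub> gmult A 1 1 \<alpha> \<beta>)"
        by (rule relator_coordinate[OF M.bilinear_algebra_L lin heis3_r_linear r_bracket mem \<gamma> rep d])
      ultimately show ?thesis
        using mc mem \<phi> product_closed[OF mem]
        by (cases "relator heis3 ?G \<phi> n u v") (auto simp: heis3_ops)
    qed
    then have "?G \<in> flat_maps heis3" using lin by (simp add: flat_maps_def)
    from flat_map_extends[OF M.lie_algebra_axioms this]
    obtain f where f: "f \<in> lie_hom (holonomy_lie A) heis3"
      and fG: "\<forall>u\<in>carrier A\<^sub>1. f (holonomy_incl u) = ?G u" by auto
    have "f ` carrier (holonomy_lie A) = carrier heis3"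
      using surjective_iff_independent[OF planar_heis3 f mem] fG ind by simp
    then show ?L using f by auto
  qed
qed

end

section \<open>Resonance\<close>

lemma coset_in_subspace:
  assumes "cspace V" "LinearCombinations.submodule class_ring W V" "x \<in> carrier V"
  shows "W +>\<^bsub>V\<^esub> x = W \<longleftrightarrow> x \<in> W"
proof -
  interpret cspace V by fact
  note W = subspaceD[OF assms(2)]
  show ?thesis
  proof
    assume "W +>\<^bsub>V\<^esub> x = W"
    moreover have "\<zero>\<^bsub>V\<^esub> \<oplus>\<^bsub>V\<^esub> x \<in> W +>\<^bsub>V\<^esub> x" using W(2) by (auto simp: a_r_coset_def')
    ultimately show "x \<in> W" using assms(3) by simp
  next
    assume x: "x \<in> W"
    show "W +>\<^bsub>V\<^esub> x = W"
    proof (intro equalityI subsetI)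
      fix w assume w: "w \<in> W"
      then have "w = (w \<oplus>\<^bsub>V\<^esub> (- 1) \<odot>\<^bsub>V\<^esub> x) \<oplus>\<^bsub>V\<^esub> x"
        using subsetD[OF W(1)] assms(3) M.a_comm[of "(- 1) \<odot>\<^bsub>V\<^esub> x" x] by (simp add: M.a_assoc)
      moreover have "w \<oplus>\<^bsub>V\<^esub> (- 1) \<odot>\<^bsub>V\<^esub> x \<in> W" using w x W(3,4) by simp
      ultimately show "w \<in> W +>\<^bsub>V\<^esub> x" by (auto simp: a_r_coset_def')
    qed (use x W in \<open>auto simp: a_r_coset_def'\<close>)
  qed
qed

lemma quotient_space_nontrivial_iff:
  assumes V: "cspace V" and W: "LinearCombinations.submodule class_ring W V"
    and Z: "Z \<subseteq> carrier V" "Z \<noteq> {}"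
  shows "carrier (quotient_space (V\<lparr>carrier := Z\<rparr>) W) \<noteq> {\<zero>\<^bsub>quotient_space (V\<lparr>carrier := Z\<rparr>) W\<^esub>}
    \<longleftrightarrow> (\<exists>x\<in>Z. x \<notin> W)"
proof -
  have "carrier (quotient_space (V\<lparr>carrier := Z\<rparr>) W) = (\<lambda>x. W +>\<^bsub>V\<^esub> x) ` Z"
    by (auto simp: quotient_space_def A_RCOSETS_def' a_r_coset_def')
  moreover have "W +>\<^bsub>V\<^esub> x = W \<longleftrightarrow> x \<in> W" if "x \<in> Z" for x
    using that Z by (intro coset_in_subspace[OF V W]) auto
  moreover have "(\<lambda>x. W +>\<^bsub>V\<^esub> x) ` Z \<noteq> {W} \<longleftrightarrow> (\<exists>x\<in>Z. W +>\<^bsub>V\<^esub> x \<noteq> W)"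
    using Z(2) by auto
  moreover have "\<zero>\<^bsub>quotient_space (V\<lparr>carrier := Z\<rparr>) W\<^esub> = W" by (simp add: quotient_space_def)
  ultimately show ?thesis by simp
qed

lemma coboundaries_one: "coboundaries V D 1 = D 0 ` carrier (V 0)"
  by (simp add: coboundaries_def One_nat_def)

text \<open>Formulated for the degrees zero to two only, so that it applies both to \<open>A\<close> and to its cohomology
  algebra: once the twisted coboundaries are the line through \<open>\<alpha>\<close>, nonvanishing of the twisted
  cohomology means that there is a twisted cocycle off that line.\<close>

lemma resonance_iff_off_line:
  assumes V: "cspace (gr B 1)" and \<alpha>: "\<alpha> \<in> carrier (gr B 1)"
    and exact: "twisted_diff B \<alpha> 0 ` carrier (gr B 0) = range (\<lambda>c. c \<odot>\<^bsub>gr B 1\<^esub> \<alpha>)"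
    and zero: "twisted_diff B \<alpha> 1 \<zero>\<^bsub>gr B 1\<^esub> = \<zero>\<^bsub>gr B 2\<^esub>"
  shows "\<alpha> \<in> resonance B \<longleftrightarrow> \<alpha> \<in> cocycles (gr B) (gdiff B) 1 \<and>
    (\<exists>\<beta>\<in>carrier (gr B 1). twisted_diff B \<alpha> 1 \<beta> = \<zero>\<^bsub>gr B 2\<^esub> \<and>
      \<beta> \<notin> range (\<lambda>c. c \<odot>\<^bsub>gr B 1\<^esub> \<alpha>))"
proof -
  interpret cspace "gr B 1" by fact
  let ?Z = "cocycles (gr B) (twisted_diff B \<alpha>) 1"
  have Z: "?Z = {\<beta> \<in> carrier (gr B 1). twisted_diff B \<alpha> 1 \<beta> = \<zero>\<^bsub>gr B 2\<^esub>}"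
    by (simp add: cocycles_def one_add_one)
  have "carrier (cohomology (gr B) (twisted_diff B \<alpha>) 1) \<noteq>
      {\<zero>\<^bsub>cohomology (gr B) (twisted_diff B \<alpha>) 1\<^esub>} \<longleftrightarrow>
      (\<exists>\<beta>\<in>?Z. \<beta> \<notin> range (\<lambda>c. c \<odot>\<^bsub>gr B 1\<^esub> \<alpha>))"
    unfolding cohomology_def coboundaries_one exact
    by (rule quotient_space_nontrivial_iff[OF V line_subspace[OF \<alpha>]]) (use zero Z in auto)
  then show ?thesis by (auto simp: resonance_def Z)
qed

context connected_cdga
begin

text \<open>The Leibniz rule for \<open>1 \<cdot> 1 = 1\<close> gives \<open>d1 = d1 + d1\<close>.\<close>

lemma diff_one: "gdiff A 0 (gone A) = \<zero>\<^bsub>gr A 1\<^esub>"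
proof -
  interpret V: cspace "gr A 1" by (rule cspace_gr)
  have d: "gdiff A 0 (gone A) \<in> carrier (gr A 1)"
    using linearD(1)[OF gdiff_linear[of 0]] gone_closed by simp
  have "gdiff A 0 (gone A) = gdiff A 0 (gone A) \<oplus>\<^bsub>gr A 1\<^esub> gdiff A 0 (gone A)"
    using leibniz[OF gone_closed gone_closed] gone_left[OF gone_closed]
      gone_left[OF d] gone_right[OF d] d by simp
  then show ?thesis using d by (metis V.M.add.l_cancel_one')
qed

lemma diff_degree_zero: "x \<in> carrier (gr A 0) \<Longrightarrow> gdiff A 0 x = \<zero>\<^bsub>gr A 1\<^esub>"
proof -
  interpret V: cspace "gr A 1" by (rule cspace_gr)
  assume "x \<in> carrier (gr A 0)"
  then obtain c where "x = c \<odot>\<^bsub>gr A 0\<^esub> gone A" using connected by auto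
  then show ?thesis using linearD(3)[OF gdiff_linear[of 0] gone_closed] diff_one by simp
qed

lemma mult_scalar:
  assumes "\<alpha> \<in> carrier (gr A 1)"
  shows "gmult A 1 0 \<alpha> (c \<odot>\<^bsub>gr A 0\<^esub> gone A) = c \<odot>\<^bsub>gr A 1\<^esub> \<alpha>"
  using linearD(3)[OF gmult_linear_right[OF assms, of 0] gone_closed] gone_right[OF assms] by simp

text \<open>The twisted differential sends \<open>c \<cdot> 1\<close> to \<open>c \<alpha>\<close>, so the twisted coboundaries in degree one are the
  multiples of \<open>\<alpha>\<close>.\<close>

lemma resonance_A_iff:
  assumes \<alpha>: "\<alpha> \<in> carrier (gr A 1)"
  shows "\<alpha> \<in> resonance A \<longleftrightarrow> gdiff A 1 \<alpha> = \<zero>\<^bsub>gr A 2\<^esub> \<and>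
    (\<exists>\<beta>\<in>carrier (gr A 1). gdiff A 1 \<beta> \<oplus>\<^bsub>gr A 2\<^esub> gmult A 1 1 \<alpha> \<beta> = \<zero>\<^bsub>gr A 2\<^esub> \<and>
      \<beta> \<notin> range (\<lambda>c. c \<odot>\<^bsub>gr A 1\<^esub> \<alpha>))"
proof -
  interpret V: cspace "gr A 1" by (rule cspace_gr)
  interpret A2: cspace "gr A 2" by (rule cspace_gr)
  have "twisted_diff A \<alpha> 0 (c \<odot>\<^bsub>gr A 0\<^esub> gone A) = c \<odot>\<^bsub>gr A 1\<^esub> \<alpha>" for c
  proof -
    have "c \<odot>\<^bsub>gr A 0\<^esub> gone A \<in> carrier (gr A 0)" unfolding connected by simp
    then show ?thesis
      using \<alpha> by (simp add: twisted_diff_def mult_scalar diff_degree_zero)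
  qed
  then have exact: "twisted_diff A \<alpha> 0 ` carrier (gr A 0) = range (\<lambda>c. c \<odot>\<^bsub>gr A 1\<^esub> \<alpha>)"
    unfolding connected by (auto simp: image_image)
  have d: "gdiff A 1 \<in> linear_maps (gr A 1) (gr A 2)"
    and m: "gmult A 1 1 \<alpha> \<in> linear_maps (gr A 1) (gr A 2)"
    using gdiff_linear[of 1] gmult_linear_right[OF \<alpha>, of 1] by (simp_all add: one_add_one)
  have t: "twisted_diff A \<alpha> 1 \<beta> = gdiff A 1 \<beta> \<oplus>\<^bsub>gr A 2\<^esub> gmult A 1 1 \<alpha> \<beta>" for \<beta>
    by (simp add: twisted_diff_def one_add_one)
  have zero: "twisted_diff A \<alpha> 1 \<zero>\<^bsub>gr A 1\<^esub> = \<zero>\<^bsub>gr A 2\<^esub>"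
    unfolding t using linear_zero[OF V.cspace_V A2.cspace_V d] linear_zero[OF V.cspace_V A2.cspace_V m]
    by simp
  show ?thesis
    unfolding resonance_iff_off_line[OF V.cspace_V \<alpha> exact zero] t
    using \<alpha> by (simp add: cocycles_def one_add_one)
qed

lemma resonance_nontrivial_iff:
  "\<not> resonance A \<subseteq> {\<zero>\<^bsub>gr A 1\<^esub>} \<longleftrightarrow>
   (\<exists>\<alpha>\<in>carrier (gr A 1). \<exists>\<beta>\<in>carrier (gr A 1). cspace.independent2 (gr A 1) \<alpha> \<beta> \<and>
      gdiff A 1 \<alpha> = \<zero>\<^bsub>gr A 2\<^esub> \<and>
      gdiff A 1 \<beta> \<oplus>\<^bsub>gr A 2\<^esub> gmult A 1 1 \<alpha> \<beta> = \<zero>\<^bsub>gr A 2\<^esub>)"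
proof -
  interpret V: cspace "gr A 1" by (rule cspace_gr)
  have "resonance A \<subseteq> carrier (gr A 1)" by (auto simp: resonance_def cocycles_def)
  then have "\<not> resonance A \<subseteq> {\<zero>\<^bsub>gr A 1\<^esub>} \<longleftrightarrow>
      (\<exists>\<alpha>\<in>carrier (gr A 1). \<alpha> \<in> resonance A \<and> \<alpha> \<noteq> \<zero>\<^bsub>gr A 1\<^esub>)" by auto
  then show ?thesis
    by (auto simp: resonance_A_iff V.independent2_iff)
qed

abbreviation H where "H \<equiv> cohomology_algebra A"
abbreviation Z\<^sub>1 where "Z\<^sub>1 \<equiv> cocycles (gr A) (gdiff A) 1"
abbreviation B\<^sub>2 where "B\<^sub>2 \<equiv> gdiff A 1 ` carrier (gr A 1)"

lemma Z\<^sub>1_subspace: "LinearCombinations.submodule class_ring Z\<^sub>1 (gr A 1)"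
proof -
  interpret V: cspace "gr A 1" by (rule cspace_gr)
  interpret A2: cspace "gr A 2" by (rule cspace_gr)
  have d: "gdiff A 1 \<in> linear_maps (gr A 1) (gr A 2)"
    using gdiff_linear[of 1] by (simp add: one_add_one)
  show ?thesis
    by (rule V.subspaceI)
      (auto simp: cocycles_def one_add_one linearD[OF d] linear_zero[OF V.cspace_V A2.cspace_V d])
qed

lemma B\<^sub>2_subspace: "LinearCombinations.submodule class_ring B\<^sub>2 (gr A 2)"
proof -
  interpret V: cspace "gr A 1" by (rule cspace_gr)
  interpret A2: cspace "gr A 2" by (rule cspace_gr)
  have d: "gdiff A 1 \<in> linear_maps (gr A 1) (gr A 2)"
    using gdiff_linear[of 1] by (simp add: one_add_one)
  show ?thesis
  proof (rule A2.subspaceI)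
    show "B\<^sub>2 \<subseteq> carrier (gr A 2)" using linearD(1)[OF d] by auto
    show "\<zero>\<^bsub>gr A 2\<^esub> \<in> B\<^sub>2"
      using linear_zero[OF V.cspace_V A2.cspace_V d] by (intro image_eqI[of _ _ "\<zero>\<^bsub>gr A 1\<^esub>"]) auto
    fix x y assume "x \<in> B\<^sub>2" "y \<in> B\<^sub>2"
    then obtain a b where "a \<in> carrier (gr A 1)" "b \<in> carrier (gr A 1)"
      "x = gdiff A 1 a" "y = gdiff A 1 b" by auto
    then show "x \<oplus>\<^bsub>gr A 2\<^esub> y \<in> B\<^sub>2"
      using linearD(2)[OF d] by (intro image_eqI[of _ _ "a \<oplus>\<^bsub>gr A 1\<^esub> b"]) auto
  next
    fix c x assume "x \<in> B\<^sub>2"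
    then obtain a where "a \<in> carrier (gr A 1)" "x = gdiff A 1 a" by auto
    then show "c \<odot>\<^bsub>gr A 2\<^esub> x \<in> B\<^sub>2"
      using linearD(3)[OF d] by (intro image_eqI[of _ _ "c \<odot>\<^bsub>gr A 1\<^esub> a"]) auto
  qed
qed

lemma coboundaries_A:
  "coboundaries (gr A) (gdiff A) 0 = {\<zero>\<^bsub>gr A 0\<^esub>}"
  "coboundaries (gr A) (gdiff A) 1 = {\<zero>\<^bsub>gr A 1\<^esub>}"
  "coboundaries (gr A) (gdiff A) 2 = B\<^sub>2"
proof -
  show "coboundaries (gr A) (gdiff A) 0 = {\<zero>\<^bsub>gr A 0\<^esub>}" by (simp add: coboundaries_def)
  have "gdiff A 0 ` carrier (gr A 0) = (\<lambda>_. \<zero>\<^bsub>gr A 1\<^esub>) ` carrier (gr A 0)"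
    by (intro image_cong refl) (simp add: diff_degree_zero)
  then show "coboundaries (gr A) (gdiff A) 1 = {\<zero>\<^bsub>gr A 1\<^esub>}"
    using gone_closed by (auto simp: coboundaries_one)
  show "coboundaries (gr A) (gdiff A) 2 = B\<^sub>2"
    by (simp add: coboundaries_def numeral_2_eq_2 One_nat_def)
qed

text \<open>In degrees zero and one there are no nonzero coboundaries, so cohomology classes are
  singletons.\<close>

lemma H_degree_one:
  "carrier (gr H 1) = (\<lambda>a. {a}) ` Z\<^sub>1"
  "\<zero>\<^bsub>gr H 1\<^esub> = {\<zero>\<^bsub>gr A 1\<^esub>}"
  "{a} \<oplus>\<^bsub>gr H 1\<^esub> {b} = {a \<oplus>\<^bsub>gr A 1\<^esub> b}"
  "a \<in> carrier (gr A 1) \<Longrightarrow> c \<odot>\<^bsub>gr H 1\<^esub> {a} = {c \<odot>\<^bsub>gr A 1\<^esub> a}"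
proof -
  interpret V: cspace "gr A 1" by (rule cspace_gr)
  have Z: "\<And>a. a \<in> Z\<^sub>1 \<Longrightarrow> a \<in> carrier (gr A 1)" by (simp add: cocycles_def)
  show "carrier (gr H 1) = (\<lambda>a. {a}) ` Z\<^sub>1"
    using Z by (auto simp: cohomology_algebra_def cohomology_def quotient_space_def coboundaries_A
        A_RCOSETS_def' a_r_coset_def')
  show "\<zero>\<^bsub>gr H 1\<^esub> = {\<zero>\<^bsub>gr A 1\<^esub>}"
    by (simp add: cohomology_algebra_def cohomology_def quotient_space_def coboundaries_A)
  show "{a} \<oplus>\<^bsub>gr H 1\<^esub> {b} = {a \<oplus>\<^bsub>gr A 1\<^esub> b}"
    by (simp add: cohomology_algebra_def cohomology_def quotient_space_def set_add_def')
  show "c \<odot>\<^bsub>gr H 1\<^esub> {a} = {c \<odot>\<^bsub>gr A 1\<^esub> a}" if "a \<in> carrier (gr A 1)"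
    using that by (simp add: cohomology_algebra_def cohomology_def quotient_space_def coboundaries_A
        a_r_coset_def')
qed

lemma cspace_H_one: "cspace (gr H 1)"
proof -
  interpret V: cspace "gr A 1" by (rule cspace_gr)
  note Z = subspaceD[OF Z\<^sub>1_subspace]
  have Z': "\<And>a. a \<in> Z\<^sub>1 \<Longrightarrow> a \<in> carrier (gr A 1)" by (simp add: cocycles_def)
  show ?thesis
  proof (rule cspaceI)
    fix X Y U assume "X \<in> carrier (gr H 1)" "Y \<in> carrier (gr H 1)" "U \<in> carrier (gr H 1)"
    then obtain x y u where "x \<in> Z\<^sub>1" "y \<in> Z\<^sub>1" "u \<in> Z\<^sub>1" "X = {x}" "Y = {y}" "U = {u}"
      unfolding H_degree_one(1) by auto
    then show "(X \<oplus>\<^bsub>gr H 1\<^esub> Y) \<oplus>\<^bsub>gr H 1\<^esub> U = X \<oplus>\<^bsub>gr H 1\<^esub> (Y \<oplus>\<^bsub>gr H 1\<^esub> U)"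
      and "X \<oplus>\<^bsub>gr H 1\<^esub> Y = Y \<oplus>\<^bsub>gr H 1\<^esub> X"
      using Z' by (simp_all add: H_degree_one V.M.a_ac)
  qed (use Z(2-4) Z' in \<open>auto simp: H_degree_one V.add_smult V.smult_add V.smult_smult\<close>)
qed

lemma twisted_diff_H_zero:
  assumes "\<alpha> \<in> carrier (gr A 1)"
  shows "twisted_diff H {\<alpha>} 0 ` carrier (gr H 0) = range (\<lambda>c. c \<odot>\<^bsub>gr H 1\<^esub> {\<alpha>})"
proof -
  interpret V0: cspace "gr A 0" by (rule cspace_gr)
  interpret V: cspace "gr A 1" by (rule cspace_gr)
  have "cocycles (gr A) (gdiff A) 0 = carrier (gr A 0)"
    using diff_degree_zero by (auto simp: cocycles_def)
  then have "carrier (gr H 0) = (\<lambda>x. {x}) ` carrier (gr A 0)"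
    by (auto simp: cohomology_algebra_def cohomology_def quotient_space_def coboundaries_A
        A_RCOSETS_def' a_r_coset_def')
  then have H0: "carrier (gr H 0) = range (\<lambda>c. {c \<odot>\<^bsub>gr A 0\<^esub> gone A})"
    unfolding connected by auto
  have "gmult H 1 0 {\<alpha>} {c \<odot>\<^bsub>gr A 0\<^esub> gone A} = {c \<odot>\<^bsub>gr A 1\<^esub> \<alpha>}" for c
    using assms by (simp add: cohomology_algebra_def coboundaries_A mult_scalar a_r_coset_def')
  moreover have "gdiff H 0 X = {\<zero>\<^bsub>gr A 1\<^esub>}" for X
    by (simp add: cohomology_algebra_def cohomology_def quotient_space_def coboundaries_A)
  ultimately have "twisted_diff H {\<alpha>} 0 {c \<odot>\<^bsub>gr A 0\<^esub> gone A} = c \<odot>\<^bsub>gr H 1\<^esub> {\<alpha>}" for c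
    using assms by (simp add: twisted_diff_def H_degree_one)
  then show ?thesis unfolding H0 by (simp add: image_image)
qed

text \<open>The differential of the cohomology algebra is zero, which leaves the class of \<open>\<alpha>\<beta>\<close> in \<open>H\<^sup>2(A)\<close>.\<close>

lemma twisted_diff_H_one:
  assumes "\<alpha> \<in> carrier (gr A 1)" "\<beta> \<in> carrier (gr A 1)"
  shows "twisted_diff H {\<alpha>} 1 {\<beta>} = \<zero>\<^bsub>gr H 2\<^esub> \<longleftrightarrow> gmult A 1 1 \<alpha> \<beta> \<in> B\<^sub>2"
proof -
  interpret A2: cspace "gr A 2" by (rule cspace_gr)
  note B = subspaceD[OF B\<^sub>2_subspace]
  have x: "gmult A 1 1 \<alpha> \<beta> \<in> carrier (gr A 2)"
    using linearD(1)[OF gmult_linear_right[OF assms(1), of 1] assms(2)] by (simp add: one_add_one)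
  have B2: "abelian_subgroup B\<^sub>2 (gr A 2)"
  proof (rule abelian_subgroupI3[OF additive_subgroup.intro])
    show "subgroup B\<^sub>2 (add_monoid (gr A 2))"
    proof (rule A2.M.add.subgroupI)
      show "\<ominus>\<^bsub>gr A 2\<^esub> a \<in> B\<^sub>2" if a: "a \<in> B\<^sub>2" for a
        using B(4)[OF a, of "- 1"] A2.minus_smult subsetD[OF B(1) a] by simp
    qed (use B in auto)
  qed (rule A2.M.abelian_group_axioms)
  have zero: "\<zero>\<^bsub>gr H 2\<^esub> = B\<^sub>2"
    by (simp add: cohomology_algebra_def cohomology_def quotient_space_def coboundaries_A)
  have "twisted_diff H {\<alpha>} 1 {\<beta>} = B\<^sub>2 <+>\<^bsub>gr A 2\<^esub> (B\<^sub>2 +>\<^bsub>gr A 2\<^esub> gmult A 1 1 \<alpha> \<beta>)"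
    by (simp add: twisted_diff_def one_add_one cohomology_algebra_def cohomology_def
        quotient_space_def coboundaries_A set_add_def')
  also have "\<dots> = (B\<^sub>2 +>\<^bsub>gr A 2\<^esub> \<zero>\<^bsub>gr A 2\<^esub>) <+>\<^bsub>gr A 2\<^esub> (B\<^sub>2 +>\<^bsub>gr A 2\<^esub> gmult A 1 1 \<alpha> \<beta>)"
    using B(1) by simp
  also have "\<dots> = B\<^sub>2 +>\<^bsub>gr A 2\<^esub> gmult A 1 1 \<alpha> \<beta>"
    using abelian_subgroup.a_rcos_sum[OF B2 _ x, of "\<zero>\<^bsub>gr A 2\<^esub>"] x by simp
  finally show ?thesis
    unfolding zero using coset_in_subspace[OF A2.cspace_V B\<^sub>2_subspace x] by simp
qed

lemma resonance_H_iff: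
  assumes \<alpha>: "\<alpha> \<in> Z\<^sub>1"
  shows "{\<alpha>} \<in> resonance H \<longleftrightarrow>
    (\<exists>\<beta>\<in>Z\<^sub>1. gmult A 1 1 \<alpha> \<beta> \<in> B\<^sub>2 \<and> \<beta> \<notin> range (\<lambda>c. c \<odot>\<^bsub>gr A 1\<^esub> \<alpha>))"
proof -
  interpret V: cspace "gr A 1" by (rule cspace_gr)
  interpret A2: cspace "gr A 2" by (rule cspace_gr)
  note Z = subspaceD[OF Z\<^sub>1_subspace] and B = subspaceD[OF B\<^sub>2_subspace]
  have Z': "\<And>a. a \<in> Z\<^sub>1 \<Longrightarrow> a \<in> carrier (gr A 1)" by (simp add: cocycles_def)
  have m: "gmult A 1 1 \<alpha> \<in> linear_maps (gr A 1) (gr A 2)"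
    using gmult_linear_right[OF Z'[OF \<alpha>], of 1] by (simp add: one_add_one)
  have cls: "{\<alpha>} \<in> carrier (gr H 1)" using \<alpha> by (simp add: H_degree_one)
  have zero: "twisted_diff H {\<alpha>} 1 \<zero>\<^bsub>gr H 1\<^esub> = \<zero>\<^bsub>gr H 2\<^esub>"
    unfolding H_degree_one(2) twisted_diff_H_one[OF Z'[OF \<alpha>] V.M.zero_closed]
    using linear_zero[OF V.cspace_V A2.cspace_V m] B(2) by simp
  have "{\<alpha>} \<in> cocycles (gr H) (gdiff H) 1"
    using cls by (simp add: cocycles_def one_add_one) (simp add: cohomology_algebra_def one_add_one)
  moreover have "range (\<lambda>c. c \<odot>\<^bsub>gr H 1\<^esub> {\<alpha>}) = (\<lambda>x. {x}) ` range (\<lambda>c. c \<odot>\<^bsub>gr A 1\<^esub> \<alpha>)"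
    using Z'[OF \<alpha>] by (simp add: H_degree_one image_image)
  moreover have singleton: "{x} \<in> (\<lambda>x. {x}) ` S \<longleftrightarrow> x \<in> S" for x :: 'a and S by auto
  ultimately show ?thesis
    unfolding resonance_iff_off_line[OF cspace_H_one cls twisted_diff_H_zero[OF Z'[OF \<alpha>]] zero] H_degree_one(1)
    using twisted_diff_H_one[OF Z'[OF \<alpha>] Z'] singleton by simp
qed

text \<open>Exactness of \<open>\<alpha>\<beta>\<close> is recorded by a primitive \<open>\<gamma>\<close> of \<open>- \<alpha>\<beta>\<close>, the form in which it occurs in the
  Maurer-Cartan equation of the Heisenberg algebra.\<close>

lemma resonance_H_nontrivial_iff:
  "\<not> resonance H \<subseteq> {\<zero>\<^bsub>gr H 1\<^esub>} \<longleftrightarrow>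
   (\<exists>\<alpha>\<in>carrier (gr A 1). \<exists>\<beta>\<in>carrier (gr A 1). \<exists>\<gamma>\<in>carrier (gr A 1).
      cspace.independent2 (gr A 1) \<alpha> \<beta> \<and>
      gdiff A 1 \<alpha> = \<zero>\<^bsub>gr A 2\<^esub> \<and> gdiff A 1 \<beta> = \<zero>\<^bsub>gr A 2\<^esub> \<and>
      gdiff A 1 \<gamma> \<oplus>\<^bsub>gr A 2\<^esub> gmult A 1 1 \<alpha> \<beta> = \<zero>\<^bsub>gr A 2\<^esub>)"
proof -
  interpret V: cspace "gr A 1" by (rule cspace_gr)
  interpret A2: cspace "gr A 2" by (rule cspace_gr)
  have d: "gdiff A 1 \<in> linear_maps (gr A 1) (gr A 2)"
    using gdiff_linear[of 1] by (simp add: one_add_one)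
  have Z: "a \<in> Z\<^sub>1 \<longleftrightarrow> a \<in> carrier (gr A 1) \<and> gdiff A 1 a = \<zero>\<^bsub>gr A 2\<^esub>" for a
    by (simp add: cocycles_def one_add_one)
  have exact: "x \<in> B\<^sub>2 \<longleftrightarrow> (\<exists>\<gamma>\<in>carrier (gr A 1). gdiff A 1 \<gamma> \<oplus>\<^bsub>gr A 2\<^esub> x = \<zero>\<^bsub>gr A 2\<^esub>)"
    if x: "x \<in> carrier (gr A 2)" for x
  proof
    assume "x \<in> B\<^sub>2"
    then obtain a where a: "a \<in> carrier (gr A 1)" "x = gdiff A 1 a" by auto
    then have "gdiff A 1 ((- 1) \<odot>\<^bsub>gr A 1\<^esub> a) = (- 1) \<odot>\<^bsub>gr A 2\<^esub> x"
      by (simp add: linearD(3)[OF d])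
    then have "gdiff A 1 ((- 1) \<odot>\<^bsub>gr A 1\<^esub> a) \<oplus>\<^bsub>gr A 2\<^esub> x = \<zero>\<^bsub>gr A 2\<^esub>"
      using x A2.M.a_comm[of "(- 1) \<odot>\<^bsub>gr A 2\<^esub> x" x] by simp
    then show "\<exists>\<gamma>\<in>carrier (gr A 1). gdiff A 1 \<gamma> \<oplus>\<^bsub>gr A 2\<^esub> x = \<zero>\<^bsub>gr A 2\<^esub>"
      using a by (intro bexI[of _ "(- 1) \<odot>\<^bsub>gr A 1\<^esub> a"]) auto
  next
    assume "\<exists>\<gamma>\<in>carrier (gr A 1). gdiff A 1 \<gamma> \<oplus>\<^bsub>gr A 2\<^esub> x = \<zero>\<^bsub>gr A 2\<^esub>"
    then obtain \<gamma> where \<gamma>: "\<gamma> \<in> carrier (gr A 1)" "gdiff A 1 \<gamma> \<oplus>\<^bsub>gr A 2\<^esub> x = \<zero>\<^bsub>gr A 2\<^esub>" by auto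
    then have "\<ominus>\<^bsub>gr A 2\<^esub> x = gdiff A 1 \<gamma>"
      using linearD(1)[OF d] x by (intro A2.M.minus_equality) auto
    then have x_eq: "x = gdiff A 1 ((- 1) \<odot>\<^bsub>gr A 1\<^esub> \<gamma>)"
      using \<gamma>(1) x linearD(1)[OF d \<gamma>(1)] by (simp add: linearD(3)[OF d] flip: A2.minus_smult) (metis A2.M.minus_minus)
    show "x \<in> B\<^sub>2" by (rule image_eqI[of _ "gdiff A 1", OF x_eq]) (use \<gamma>(1) in simp)
  qed
  have m: "gmult A 1 1 a b \<in> carrier (gr A 2)" if "a \<in> carrier (gr A 1)" "b \<in> carrier (gr A 1)" for a b
    using linearD(1)[OF gmult_linear_right[OF that(1), of 1] that(2)] by (simp add: one_add_one)
  have sub: "resonance H \<subseteq> (\<lambda>a. {a}) ` Z\<^sub>1"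
    using H_degree_one(1) by (auto simp: resonance_def cocycles_def)
  have "\<not> resonance H \<subseteq> {\<zero>\<^bsub>gr H 1\<^esub>} \<longleftrightarrow> (\<exists>\<alpha>\<in>Z\<^sub>1. {\<alpha>} \<in> resonance H \<and> \<alpha> \<noteq> \<zero>\<^bsub>gr A 1\<^esub>)"
    unfolding H_degree_one(2) using sub by fast
  also have "\<dots> \<longleftrightarrow> (\<exists>\<alpha>\<in>Z\<^sub>1. \<exists>\<beta>\<in>Z\<^sub>1. V.independent2 \<alpha> \<beta> \<and> gmult A 1 1 \<alpha> \<beta> \<in> B\<^sub>2)"
    using Z by (auto simp: resonance_H_iff V.independent2_iff)
  also have "\<dots> \<longleftrightarrow> (\<exists>\<alpha>\<in>Z\<^sub>1. \<exists>\<beta>\<in>Z\<^sub>1. V.independent2 \<alpha> \<beta> \<and>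
      (\<exists>\<gamma>\<in>carrier (gr A 1). gdiff A 1 \<gamma> \<oplus>\<^bsub>gr A 2\<^esub> gmult A 1 1 \<alpha> \<beta> = \<zero>\<^bsub>gr A 2\<^esub>))"
    using Z exact[OF m] by (intro bex_cong refl) simp
  finally show ?thesis unfolding Bex_def Z by blast
qed

end

theorem proposition4p12:
  fixes A :: "'a dga"
  assumes "one_finite_cdga A"
  shows
    "(\<not> resonance A \<subseteq> {\<zero>\<^bsub>gr A 1\<^esub>} \<longleftrightarrow>
       (\<exists>f\<in>lie_hom (holonomy_lie A) sol2. f ` carrier (holonomy_lie A) = carrier sol2)) \<and>
     (\<not> resonance (cohomology_algebra A) \<subseteq> {\<zero>\<^bsub>gr (cohomology_algebra A) 1\<^esub>} \<longleftrightarrow>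
       (\<exists>f\<in>lie_hom (holonomy_lie A) heis3. f ` carrier (holonomy_lie A) = carrier heis3))"
proof -
  interpret one_finite_cdga A by fact
  show ?thesis
    unfolding sol2_surjection_iff heis3_surjection_iff
      resonance_nontrivial_iff resonance_H_nontrivial_iff by simp
qed

end
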